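(* Suppose that $f$ and $g$ are Möbius transformations such that the semigroup $\langle f,g\rangle$ is nonelementary and semidiscrete. Then either there is a closed interval that both $f$ and $g$ map strictly inside itself, or else $$\lvert \mathrm{Tr}(F)^2-4\rvert+\lvert\mathrm{Tr}[F,G]-2\rvert\geq 1,$$ where $F$ and $G$ are lifts of $f$ and $g$, respectively, to $\mathrm{SL}(2,\mathbb{R})$.
   Context: $\mathbb{H}$ is the upper half-plane, $\overline{\mathbb{R}}=\mathbb{R}\cup\{\infty\}$, $\overline{\mathbb{H}}=\mathbb{H}\cup\overline{\mathbb{R}}$. "Möbius transformation" means $z\mapsto (az+b)/(cz+d)$ with $a,b,c,d\in\mathbb{R}$, $ad-bc>0$; these form the topological group $\mathcal{M}\cong\mathrm{PSL}(2,\mathbb{R})$ with identity $I$. $\langle f,g\rangle$ denotes the semigroup (not the group) generated by $f$ and $g$. A semigroup $S\subset\mathcal{M}$ is semidiscrete if $I$ is not an accumulation point of $S$ in $\mathcal{M}$. $S$ is elementary if it has a finite orbit in its action on $\overline{\mathbb{H}}$, and nonelementary otherwise. A closed interval is a closed interval in the circle $\overline{\mathbb{R}}$ that is neither a singleton nor all of $\overline{\mathbb{R}}$; $h$ maps $J$ strictly inside itself if $h(J)\subset J$ and $h(J)\neq J$. $\mathrm{Tr}$ is the matrix trace and $[F,G]=FGF^{-1}G^{-1}$; the two quantities in the inequality do not depend on the choice of lifts. *)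

theory Defs
  imports "HOL-Analysis.Analysis"
begin

text \<open>The Riemann sphere is the one-point compactification of the complex plane, realised on the
  type \<^typ>\<open>complex option\<close> with \<^term>\<open>None\<close> as the point at infinity.\<close>

definition ext_reals :: "complex option set" where
  "ext_reals = insert None (Some ` \<real>)"

definition closed_half_plane :: "complex option set" where
  "closed_half_plane = Some ` {z. Im z > 0} \<union> ext_reals"

definition ext_reals_topology :: "complex option topology" where
  "ext_reals_topology = subtopology (Alexandroff_compactification euclidean) ext_reals"

text \<open>The extended real line is a circle, so its closed connected subsets are the closed arcs,
  together with the empty set, the singletons and the whole circle.  An interval may contain the
  point at infinity.\<close>

definition closed_interval :: "complex option set \<Rightarrow> bool" where
  "closed_interval J \<longleftrightarrow>
     closedin ext_reals_topology J \<and> connectedin ext_reals_topology J \<and>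
     J \<noteq> {} \<and> (\<nexists>p. J = {p}) \<and> J \<noteq> ext_reals"

definition strictly_inside_itself :: "('a \<Rightarrow> 'a) \<Rightarrow> 'a set \<Rightarrow> bool" where
  "strictly_inside_itself h J \<longleftrightarrow> h ` J \<subseteq> J \<and> h ` J \<noteq> J"

text \<open>The map \<open>z \<mapsto> (a z + b) / (c z + d)\<close>, extended to infinity and to the pole in the usual way;
  it is meaningful only when the determinant is nonzero.\<close>

definition moebius_map :: "real^2^2 \<Rightarrow> complex option \<Rightarrow> complex option" where
  "moebius_map A p =
     (let a = complex_of_real (A$1$1); b = complex_of_real (A$1$2);
          c = complex_of_real (A$2$1); d = complex_of_real (A$2$2)
      in case p of
           None \<Rightarrow> (if c = 0 then None else Some (a / c))
         | Some z \<Rightarrow> (if c * z + d = 0 then None else Some ((a * z + b) / (c * z + d))))"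

definition moebius_group :: "(complex option \<Rightarrow> complex option) set" where
  "moebius_group = moebius_map ` {A. det A > 0}"

definition SL2 :: "(real^2^2) set" where
  "SL2 = {A. det A = 1}"

definition is_lift :: "real^2^2 \<Rightarrow> (complex option \<Rightarrow> complex option) \<Rightarrow> bool" where
  "is_lift F f \<longleftrightarrow> F \<in> SL2 \<and> moebius_map F = f"

text \<open>The topology of \<open>PSL(2, \<real>)\<close>: the quotient topology along \<^const>\<open>moebius_map\<close>, which
  identifies exactly \<open>A\<close> and \<open>-A\<close> on \<^const>\<open>SL2\<close>.\<close>

definition moebius_topology :: "(complex option \<Rightarrow> complex option) topology" where
  "moebius_topology =
     topology (\<lambda>U. U \<subseteq> moebius_group \<and>
                   openin (top_of_set SL2) {A \<in> SL2. moebius_map A \<in> U})"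

inductive_set semigroup_generated :: "('a \<Rightarrow> 'a) set \<Rightarrow> ('a \<Rightarrow> 'a) set"
  for X :: "('a \<Rightarrow> 'a) set" where
  gen: "h \<in> X \<Longrightarrow> h \<in> semigroup_generated X"
| comp: "h \<in> semigroup_generated X \<Longrightarrow> k \<in> semigroup_generated X
    \<Longrightarrow> h \<circ> k \<in> semigroup_generated X"

definition semidiscrete :: "(complex option \<Rightarrow> complex option) set \<Rightarrow> bool" where
  "semidiscrete S \<longleftrightarrow> id \<notin> moebius_topology derived_set_of S"

definition elementary :: "(complex option \<Rightarrow> complex option) set \<Rightarrow> bool" where
  "elementary S \<longleftrightarrow> (\<exists>p \<in> closed_half_plane. finite ((\<lambda>h. h p) ` S))"

definition commutator :: "real^2^2 \<Rightarrow> real^2^2 \<Rightarrow> real^2^2" where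
  "commutator F G = F ** G ** matrix_inv F ** matrix_inv G"


lemma openin_moebius_topology:
  "openin moebius_topology U \<longleftrightarrow>
     U \<subseteq> moebius_group \<and> openin (top_of_set SL2) {A \<in> SL2. moebius_map A \<in> U}"
proof -
  have "istopology (\<lambda>U. U \<subseteq> moebius_group \<and>
                   openin (top_of_set SL2) {A \<in> SL2. moebius_map A \<in> U})" (is "istopology ?P")
    unfolding istopology_def
  proof (intro conjI allI impI)
    fix S T assume "?P S" "?P T"
    moreover have "{A \<in> SL2. moebius_map A \<in> S \<inter> T} =
        {A \<in> SL2. moebius_map A \<in> S} \<inter> {A \<in> SL2. moebius_map A \<in> T}" by blast
    ultimately show "S \<inter> T \<subseteq> moebius_group"
      and "openin (top_of_set SL2) {A \<in> SL2. moebius_map A \<in> S \<inter> T}"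
      by (auto intro: openin_Int)
  next
    fix K assume K: "\<forall>U\<in>K. ?P U"
    then show "\<Union> K \<subseteq> moebius_group" by blast
    have "{A \<in> SL2. moebius_map A \<in> \<Union> K} = \<Union> ((\<lambda>U. {A \<in> SL2. moebius_map A \<in> U}) ` K)"
      by blast
    moreover have "openin (top_of_set SL2) (\<Union> ((\<lambda>U. {A \<in> SL2. moebius_map A \<in> U}) ` K))"
      by (rule openin_Union) (use K in blast)
    ultimately show "openin (top_of_set SL2) {A \<in> SL2. moebius_map A \<in> \<Union> K}"
      by (simp only:)
  qed
  then show ?thesis
    unfolding moebius_topology_def by (simp add: topology_inverse')
qed

lemma moebius_map_scale:
  assumes "r \<noteq> 0"
  shows "moebius_map (r *\<^sub>R A) = moebius_map A"
proof
  fix p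
  have *: "complex_of_real r * x * z + complex_of_real r * y = of_real r * (x * z + y)" for x y z
    by (simp add: algebra_simps)
  show "moebius_map (r *\<^sub>R A) p = moebius_map A p"
    using assms by (cases p) (auto simp: moebius_map_def Let_def *)
qed

lemma moebius_group_eq_SL2: "moebius_group = moebius_map ` SL2"
proof
  show "moebius_map ` SL2 \<subseteq> moebius_group"
    by (auto simp: moebius_group_def SL2_def)
  show "moebius_group \<subseteq> moebius_map ` SL2"
  proof
    fix f assume "f \<in> moebius_group"
    then obtain A where A: "det A > 0" "f = moebius_map A" by (auto simp: moebius_group_def)
    define r where "r = 1 / sqrt (det A)"
    have r: "r \<noteq> 0" "r * r * det A = 1" using A(1) by (auto simp: r_def)
    have "det (r *\<^sub>R A) = r * r * det A" by (simp add: det_2 algebra_simps)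
    with r have "r *\<^sub>R A \<in> SL2" by (simp add: SL2_def)
    moreover have "f = moebius_map (r *\<^sub>R A)" using A r moebius_map_scale by simp
    ultimately show "f \<in> moebius_map ` SL2" by blast
  qed
qed

lemma topspace_moebius_topology [simp]: "topspace moebius_topology = moebius_group"
proof -
  have "{A \<in> SL2. moebius_map A \<in> moebius_group} = SL2"
    by (auto simp: moebius_group_eq_SL2)
  then have "openin moebius_topology moebius_group"
    by (simp add: openin_moebius_topology)
  then show ?thesis
    by (metis openin_moebius_topology openin_subset openin_topspace subset_antisym)
qed

lemma quotient_map_moebius_map: "quotient_map (top_of_set SL2) moebius_topology moebius_map"
  by (simp add: quotient_map_def openin_moebius_topology flip: moebius_group_eq_SL2)

lemma moebius_map_mat_1: "moebius_map (mat 1) = id"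
  by (rule ext) (auto simp: moebius_map_def mat_def split: option.split)

lemma moebius_map_mult:
  assumes "det A \<noteq> 0" "det B \<noteq> 0"
  shows "moebius_map (A ** B) = moebius_map A \<circ> moebius_map B"
proof
  fix p
  define a b c d where ab: "a = complex_of_real (A$1$1)" "b = complex_of_real (A$1$2)"
    "c = complex_of_real (A$2$1)" "d = complex_of_real (A$2$2)"
  define a' b' c' d' where ab': "a' = complex_of_real (B$1$1)" "b' = complex_of_real (B$1$2)"
    "c' = complex_of_real (B$2$1)" "d' = complex_of_real (B$2$2)"
  have "complex_of_real (det A) \<noteq> 0" "complex_of_real (det B) \<noteq> 0" using assms by auto
  then have dt: "a * d - b * c \<noteq> 0" "a' * d' - b' * c' \<noteq> 0"
    unfolding ab ab' det_2 by simp_all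
  define M where "M = (\<lambda>a b c d p. case p of
           None \<Rightarrow> (if c = 0 then None else Some (a / c))
         | Some z \<Rightarrow> (if c * z + d = 0 then None else Some ((a * z + b) / (c * z + d :: complex))))"
  have M: "moebius_map A = M a b c d" "moebius_map B = M a' b' c' d'"
    "moebius_map (A ** B) =
       M (a * a' + b * c') (a * b' + b * d') (c * a' + d * c') (c * b' + d * d')"
    by (rule ext, simp add: moebius_map_def M_def Let_def ab ab' matrix_matrix_mult_def sum_2)+
  have key: "(if c * u + d * v = 0 then None else Some ((a * u + b * v) / (c * u + d * v)))
      = M a b c d (if v = 0 then None else Some (u / v))" if "u \<noteq> 0 \<or> v \<noteq> 0" for u v
  proof (cases "v = 0")
    case True
    then show ?thesis using that by (auto simp: M_def)
  next
    case False
    then have "c * u + d * v = v * (c * (u / v) + d)" "a * u + b * v = v * (a * (u / v) + b)"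
      by (simp_all add: field_simps)
    then show ?thesis using False by (simp add: M_def)
  qed
  have "M (a * a' + b * c') (a * b' + b * d') (c * a' + d * c') (c * b' + d * d') p
      = M a b c d (M a' b' c' d' p)"
  proof (cases p)
    case None
    have "a' \<noteq> 0 \<or> c' \<noteq> 0" using dt by auto
    from key[OF this] show ?thesis using None by (simp add: M_def)
  next
    case (Some z)
    have "a' * z + b' \<noteq> 0 \<or> c' * z + d' \<noteq> 0"
    proof (rule ccontr)
      assume "\<not> ?thesis"
      then have "a' * z = - b'" "c' * z = - d'" by (auto simp: eq_neg_iff_add_eq_0)
      have "z * (a' * d' - b' * c') = (a' * z) * d' - b' * (c' * z)"
        by (simp add: algebra_simps)
      also have "\<dots> = 0"
        unfolding \<open>a' * z = - b'\<close> \<open>c' * z = - d'\<close> by simp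
      finally have "z = 0" using dt by simp
      with \<open>a' * z = - b'\<close> \<open>c' * z = - d'\<close> dt show False by simp
    qed
    have e: "M (a * a' + b * c') (a * b' + b * d') (c * a' + d * c') (c * b' + d * d') p =
        (let u = a' * z + b'; v = c' * z + d'
         in if c * u + d * v = 0 then None else Some ((a * u + b * v) / (c * u + d * v)))"
      unfolding M_def Some Let_def option.case by (simp only: algebra_simps)
    have "M a' b' c' d' p =
        (if c' * z + d' = 0 then None else Some ((a' * z + b') / (c' * z + d')))"
      by (simp add: M_def Some)
    with e key[OF \<open>a' * z + b' \<noteq> 0 \<or> c' * z + d' \<noteq> 0\<close>] show ?thesis
      by (simp only: Let_def)
  qed
  then show "moebius_map (A ** B) p = (moebius_map A \<circ> moebius_map B) p"
    by (simp add: M)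
qed

end

theory Submission
  imports Defs
begin

text \<open>
  Lift the semigroup to a set \<open>M\<close> of matrices and let \<open>U\<close> consist of those whose inverse is also in
  \<open>M\<close>.  Bounded subsets of \<open>U\<close> are finite, and every elliptic element of \<open>M\<close> lies in \<open>U\<close>, because
  its powers are bounded and hence repeat.  Suppose the inequality fails, and write \<open>\<kappa> = Tr [F, G]\<close>,
  so that \<open>\<kappa> < 3\<close>; choose lifts with nonnegative traces.  If \<open>F\<close> is elliptic, some \<open>F^n G\<close> is elliptic
  as well, so \<open>F\<close> and \<open>G\<close> lie in \<open>U\<close>.  If neither is elliptic, then their axes cross (\<open>\<kappa> < 2\<close>), or are
  disjoint and point the same way (\<open>Tr F Tr G < 2 Tr FG\<close>), and both maps shrink a common interval; or
  the axes are disjoint and point in opposite ways, and then a Euclidean algorithm on traces, which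
  terminates because \<open>2 < \<kappa> < 18\<close>, produces an elliptic word involving both maps, so that again \<open>F\<close>
  and \<open>G\<close> lie in \<open>U\<close>.  In that case the classical argument of Joergensen applies: with \<open>F\<close> in normal
  form, the step from \<open>G\<close> to \<open>F\<close> conjugated by \<open>G\<close> decreases a matrix quantity forever within a bounded
  subset of \<open>U\<close>, unless \<open>F\<close> and \<open>G\<close> generate an elementary group.
\<close>

subsection \<open>Two by two matrices and traces\<close>

definition mat2 :: "real \<Rightarrow> real \<Rightarrow> real \<Rightarrow> real \<Rightarrow> real^2^2" where
  "mat2 a b c d = vector [vector [a, b], vector [c, d]]"

lemma mat2_nth [simp]:
  "mat2 a b c d $ 1 $ 1 = a" "mat2 a b c d $ 1 $ 2 = b"
  "mat2 a b c d $ 2 $ 1 = c" "mat2 a b c d $ 2 $ 2 = d"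
  by (simp_all add: mat2_def)

lemma mat2_eq_iff: "A = mat2 a b c d \<longleftrightarrow> A$1$1 = a \<and> A$1$2 = b \<and> A$2$1 = c \<and> A$2$2 = d"
  by (simp add: vec_eq_iff forall_2)

lemma mat2_inject [simp]: "mat2 a b c d = mat2 a' b' c' d' \<longleftrightarrow> a = a' \<and> b = b' \<and> c = c' \<and> d = d'"
  by (auto simp: mat2_eq_iff)

lemma mat2_cases: obtains a b c d where "A = mat2 a b c d"
  by (metis mat2_eq_iff)

lemma mat2_mult [simp]:
  "mat2 a b c d ** mat2 a' b' c' d' = mat2 (a*a' + b*c') (a*b' + b*d') (c*a' + d*c') (c*b' + d*d')"
  by (simp add: mat2_eq_iff matrix_matrix_mult_def sum_2)

lemma mat2_one: "mat 1 = mat2 1 0 0 1"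
  by (simp add: mat2_eq_iff mat_def)

lemma mat2_uminus [simp]: "- mat2 a b c d = mat2 (-a) (-b) (-c) (-d)"
  by (simp add: mat2_eq_iff)

lemma det_mat2 [simp]: "det (mat2 a b c d) = a*d - b*c"
  by (simp add: det_2)

lemma trace_mat2 [simp]: "trace (mat2 a b c d) = a + d"
  by (simp add: trace_def sum_2)

text \<open>The adjugate. It is the inverse on determinant one, and being given by entries it lends
  itself to computation and to limits.\<close>

definition adj :: "real^2^2 \<Rightarrow> real^2^2" where
  "adj A = mat2 (A$2$2) (- A$1$2) (- A$2$1) (A$1$1)"

lemma adj_mat2 [simp]: "adj (mat2 a b c d) = mat2 d (-b) (-c) a"
  by (simp add: adj_def)

lemma adj_adj [simp]: "adj (adj A) = A"
  by (cases A rule: mat2_cases) simp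

lemma adj_mult: "adj (A ** B) = adj B ** adj A"
  by (cases A rule: mat2_cases; cases B rule: mat2_cases) (simp add: algebra_simps)

lemma adj_uminus: "adj (- A) = - adj A"
  by (cases A rule: mat2_cases) simp

lemma mult_adj:
  assumes "det A = 1" shows "A ** adj A = mat 1" "adj A ** A = mat 1"
  using assms by (cases A rule: mat2_cases, simp add: mat2_one algebra_simps)+

lemma mult_adj_cancel:
  assumes "det A = 1" shows "A ** (adj A ** B) = B" "adj A ** (A ** B) = B"
  by (simp_all add: matrix_mul_assoc mult_adj[OF assms])

lemma matrix_inv_eq_adj:
  assumes "det A = 1" shows "matrix_inv A = adj A"
  proof -
  have "A ** matrix_inv A = mat 1 \<and> matrix_inv A ** A = mat 1"
    unfolding matrix_inv_def by (rule someI[of _ "adj A"]) (simp add: mult_adj[OF assms])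
  then have "adj A ** (A ** matrix_inv A) = adj A" by simp
  then show ?thesis by (simp add: mult_adj_cancel(2)[OF assms])
qed

lemma trace_uminus2: "trace (- (A :: real^2^2)) = - trace A"
  by (cases A rule: mat2_cases) simp

lemma det_uminus2: "det (- (A :: real^2^2)) = det A"
  by (cases A rule: mat2_cases) simp

lemma mult_uminus2: "- A ** B = - (A ** B)" "A ** - B = - (A ** B)" for A B :: "real^2^2"
  by (cases A rule: mat2_cases; cases B rule: mat2_cases; simp)+

text \<open>Multiply \<open>F^2 = trace F * F - I\<close> by \<open>G\<close> and take traces. This
  recursion drives both trace algorithms below.\<close>

lemma cayley_hamilton:
  fixes F G :: "real^2^2"
  assumes "det F = 1"
  shows "trace (F ** (F ** G)) = trace F * trace (F ** G) - trace G"
proof -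
  obtain p q r s where F: "F = mat2 p q r s" by (rule mat2_cases)
  obtain a b c d where G: "G = mat2 a b c d" by (rule mat2_cases)
  have *: "p * s - q * r = 1" using assms by (simp add: F)
  show ?thesis unfolding F G using * by simp algebra
qed

lemma trace_commutator:
  assumes "det F = 1" "det G = 1"
  shows "trace (commutator F G) =
    (trace F)\<^sup>2 + (trace G)\<^sup>2 + (trace (F ** G))\<^sup>2 - trace F * trace G * trace (F ** G) - 2"
proof -
  obtain p q r s where F: "F = mat2 p q r s" by (rule mat2_cases)
  obtain a b c d where G: "G = mat2 a b c d" by (rule mat2_cases)
  have *: "p * s - q * r = 1" "a * d - b * c = 1" using assms by (simp_all add: F G)
  show ?thesis unfolding commutator_def matrix_inv_eq_adj[OF assms(1)] matrix_inv_eq_adj[OF assms(2)]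
    unfolding F G using * by simp algebra
qed

text \<open>Fricke's polynomial: by \<open>trace_commutator\<close> it is the commutator trace in
  terms of the traces of \<open>F\<close>, \<open>G\<close> and \<open>F ** G\<close>. Being
  symmetric and quadratic in each variable, it is invariant under replacing \<open>y\<close> by
  \<open>x * z - y\<close>, which is, up to order, the passage from \<open>(F, G)\<close> to
  \<open>(F, F ** G)\<close>.\<close>

definition fricke :: "real \<Rightarrow> real \<Rightarrow> real \<Rightarrow> real" where
  "fricke x y z = x\<^sup>2 + y\<^sup>2 + z\<^sup>2 - x * y * z - 2"

text \<open>As a quadratic in \<open>y\<close> the polynomial decreases up to
  \<open>x * z / 2\<close>, so for \<open>x \<le> z\<close> it is largest at \<open>y = z\<close>;
  there its excess over 2 is \<open>(x - 2) * (x + 2 - z\<^sup>2)\<close>, at most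
  \<open>- ((x - 2)\<^sup>2 * (x + 1))\<close>. Such triples are those where replacing the largest
  trace brings no decrease.\<close>

lemma fricke_reduced_le:
  assumes "2 \<le> x" "2 \<le> z" "x \<le> y" "z \<le> y" "2 * y \<le> x * z"
  shows "fricke x y z \<le> 2"
proof -
  have main: "fricke x y z \<le> 2" if "2 \<le> x" "x \<le> z" "z \<le> y" "2 * y \<le> x * z" for x y z :: real
  proof -
    have "(y - z) * (y + z - x * z) \<le> 0"
      using that by (intro mult_nonneg_nonpos) auto
    moreover have "(x - 2) * x\<^sup>2 \<le> (x - 2) * z\<^sup>2"
      using that by (intro mult_left_mono power_mono) auto
    moreover have "0 \<le> (x - 2)\<^sup>2 * (x + 1)" using that by simp
    ultimately show ?thesis
      unfolding fricke_def by (simp add: power2_eq_square algebra_simps)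
  qed
  show ?thesis
  proof (cases "x \<le> z")
    case True then show ?thesis using main[of x z y] assms by simp
  next
    case False
    then show ?thesis using main[of z x y] assms by (simp add: fricke_def mult_ac add_ac)
  qed
qed

text \<open>The two sides differ by exactly \<open>(x - 2) * (y * z - x - 2)\<close>. This bounds
  from below the loss of trace in a Euclidean step.\<close>

lemma fricke_gap:
  assumes "2 \<le> x" "2 \<le> y * z - x"
  shows "fricke x y z - 2 \<le> (y - z)\<^sup>2"
proof -
  have "(x - 2) * (y * z - x - 2) \<ge> 0" using assms by simp
  then show ?thesis unfolding fricke_def by (simp add: power2_eq_square algebra_simps)
qed

text \<open>Equality holds at \<open>(2, 2, -2)\<close>. The bound keeps products in the Euclidean
  algorithm above trace -2, so that a product of trace below 2 is elliptic.\<close>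

lemma fricke_ge_18:
  assumes "2 \<le> x" "2 \<le> y" "z \<le> -2"
  shows "18 \<le> fricke x y z"
proof -
  have "2 * 2 \<le> x * y" "2 * 2 \<le> z * z" using assms mult_mono[of 2 x 2 y] mult_mono[of 2 "-z" 2 "-z"] by auto
  moreover have "x * y * 2 \<le> x * y * (-z)" using assms by (intro mult_left_mono) auto
  moreover have "0 \<le> (x - y)\<^sup>2" by simp
  ultimately show ?thesis unfolding fricke_def by (simp add: power2_eq_square algebra_simps)
qed

section \<open>Limits and bounds of matrices\<close>

lemma tendsto_matrix_mult:
  fixes X :: "nat \<Rightarrow> real^2^2"
  assumes "X \<longlonglongrightarrow> L" "Y \<longlonglongrightarrow> K"
  shows "(\<lambda>n. X n ** Y n) \<longlonglongrightarrow> L ** (K::real^2^2)"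
  unfolding matrix_matrix_mult_def
  by (intro tendsto_vec_lambda tendsto_sum tendsto_mult tendsto_vec_nth assms)

lemma tendsto_adj:
  assumes "X \<longlonglongrightarrow> L" shows "(\<lambda>n. adj (X n)) \<longlonglongrightarrow> adj L"
proof (intro vec_tendstoI)
  fix i j :: 2
  have "\<And>k l. (\<lambda>n. X n $ k $ l) \<longlonglongrightarrow> L $ k $ l"
    using assms by (intro tendsto_vec_nth)
  then show "(\<lambda>n. adj (X n) $ i $ j) \<longlonglongrightarrow> adj L $ i $ j"
    using exhaust_2[of i] exhaust_2[of j] by (auto simp: adj_def tendsto_minus_cancel_left[symmetric])
qed

definition entries_le :: "real \<Rightarrow> real^2^2 \<Rightarrow> bool" where
  "entries_le K A \<longleftrightarrow> (\<forall>i j. \<bar>A $ i $ j\<bar> \<le> K)"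

lemma entries_le_mat2 [simp]:
  "entries_le K (mat2 a b c d) \<longleftrightarrow> \<bar>a\<bar> \<le> K \<and> \<bar>b\<bar> \<le> K \<and> \<bar>c\<bar> \<le> K \<and> \<bar>d\<bar> \<le> K"
  by (auto simp: entries_le_def forall_2)

lemma bounded_entries_le: "bounded {A. entries_le K A}"
  unfolding bounded_iff
proof (intro exI ballI)
  fix A assume "A \<in> {A. entries_le K A}"
  then have *: "\<And>i j. norm (A $ i $ j) \<le> K" by (simp add: entries_le_def)
  have "norm A \<le> (\<Sum>i\<in>UNIV. norm (A $ i))" by (simp add: norm_vec_def L2_set_le_sum)
  also have "\<dots> \<le> (\<Sum>i\<in>(UNIV::2 set). \<Sum>j\<in>(UNIV::2 set). norm (A $ i $ j))"
    unfolding norm_vec_def[of "A $ _"] by (intro sum_mono L2_set_le_sum) auto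
  also have "\<dots> \<le> (\<Sum>i\<in>(UNIV::2 set). \<Sum>j\<in>(UNIV::2 set). K)"
    by (intro sum_mono *)
  finally show "norm A \<le> (\<Sum>i\<in>(UNIV::2 set). \<Sum>j\<in>(UNIV::2 set). K)" .
qed

subsection \<open>Semidiscrete matrix semigroups\<close>

text \<open>\<open>M\<close> models the set of all lifts of a semidiscrete semigroup, hence the
  closure under negation. Isolation of the identity is put in sequential form.\<close>

locale semidiscrete_matrices =
  fixes M :: "(real^2^2) set"
  assumes det_M: "A \<in> M \<Longrightarrow> det A = 1"
    and mult_M: "A \<in> M \<Longrightarrow> B \<in> M \<Longrightarrow> A ** B \<in> M"
    and uminus_M: "A \<in> M \<Longrightarrow> - A \<in> M"
    and one_isolated: "\<And>X. (\<And>n. X n \<in> M) \<Longrightarrow> X \<longlonglongrightarrow> mat 1 \<Longrightarrow> \<exists>n::nat. X n = mat 1"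
begin

text \<open>The units of the semigroup. Quotients of elements of \<open>M\<close> may leave
  \<open>M\<close>, those of units do not, so arguments about discrete groups apply to
  \<open>U\<close>.\<close>

definition U :: "(real^2^2) set" where
  "U = {A \<in> M. adj A \<in> M}"

lemma U_det: "A \<in> U \<Longrightarrow> det A = 1"
  by (auto simp: U_def det_M)

lemma U_M: "A \<in> U \<Longrightarrow> A \<in> M"
  by (simp add: U_def)

lemma U_mult: "A \<in> U \<Longrightarrow> B \<in> U \<Longrightarrow> A ** B \<in> U"
  by (auto simp: U_def adj_mult mult_M)

lemma U_adj: "A \<in> U \<Longrightarrow> adj A \<in> U"
  by (auto simp: U_def)

lemma U_uminus_iff: "- A \<in> U \<longleftrightarrow> A \<in> U"
  using uminus_M[of A] uminus_M[of "-A"] uminus_M[of "adj A"] uminus_M[of "- adj A"]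
  by (auto simp: U_def adj_uminus)

text \<open>The inverse of \<open>A ** B\<close> times \<open>B\<close> on the left is the inverse
  of \<open>A\<close>, and times \<open>A\<close> on the right is the inverse of \<open>B\<close>.
  Thus a unit found as a word makes its letters units.\<close>

lemma U_factors:
  assumes "A \<in> M" "B \<in> M" "A ** B \<in> U"
  shows "A \<in> U" "B \<in> U"
proof -
  have C: "adj B ** adj A \<in> M" using assms(3) by (simp add: U_def adj_mult)
  have "B ** (adj B ** adj A) \<in> M" "(adj B ** adj A) ** A \<in> M"
    using C assms by (auto intro: mult_M)
  then have "adj A \<in> M" "adj B \<in> M"
    using det_M[OF assms(1)] det_M[OF assms(2)]
    by (simp_all add: mult_adj_cancel mult_adj flip: matrix_mul_assoc)
  then show "A \<in> U" "B \<in> U" using assms by (auto simp: U_def)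
qed

text \<open>Along a convergent subsequence the quotients of consecutive terms tend to the identity,
  so one of them equals it. Only quotients of later by earlier terms are required in
  \<open>M\<close>, so the powers of a single element of \<open>M\<close> qualify.\<close>

lemma bounded_sequence_repeats:
  fixes X :: "nat \<Rightarrow> real^2^2"
  assumes bdd: "bounded (range X)" and det: "\<And>n. det (X n) = 1"
    and quot: "\<And>m n. m < n \<Longrightarrow> X n ** adj (X m) \<in> M"
  shows "\<exists>m n. m < n \<and> X n = X m"
proof -
  obtain l r where r: "strict_mono r" and lim: "(X \<circ> r) \<longlonglongrightarrow> l"
    using bounded_imp_convergent_subsequence[OF bdd] by auto
  have lim2: "(\<lambda>n. (X \<circ> r) (Suc n)) \<longlonglongrightarrow> l" using lim by (rule LIMSEQ_Suc)
  have "(\<lambda>n. (X \<circ> r) n ** adj ((X \<circ> r) n)) \<longlonglongrightarrow> l ** adj l"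
    by (intro tendsto_matrix_mult tendsto_adj lim)
  then have "l ** adj l = mat 1"
    by (simp add: mult_adj det LIMSEQ_const_iff)
  then have "(\<lambda>n. (X \<circ> r) (Suc n) ** adj ((X \<circ> r) n)) \<longlonglongrightarrow> mat 1"
    using tendsto_matrix_mult[OF lim2 tendsto_adj[OF lim]] by simp
  moreover have less: "r n < r (Suc n)" for n using r by (simp add: strict_mono_def)
  ultimately obtain n where "X (r (Suc n)) ** adj (X (r n)) = mat 1"
    using one_isolated[of "\<lambda>n. (X \<circ> r) (Suc n) ** adj ((X \<circ> r) n)"] quot by auto
  then have "X (r (Suc n)) ** adj (X (r n)) ** X (r n) = X (r n)" by simp
  then have "X (r (Suc n)) = X (r n)"
    by (simp add: mult_adj det flip: matrix_mul_assoc)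
  with less show ?thesis by blast
qed

lemma finite_bounded_subset_U:
  assumes "T \<subseteq> U" "\<And>A. A \<in> T \<Longrightarrow> entries_le K A"
  shows "finite T"
proof (rule ccontr)
  assume "infinite T"
  then obtain X :: "nat \<Rightarrow> _" where X: "inj X" "range X \<subseteq> T"
    using infinite_countable_subset by blast
  then have *: "X n \<in> U" for n using assms(1) by auto
  have "bounded (range X)"
    using X assms(2) by (intro bounded_subset[OF bounded_entries_le[of K]]) auto
  then have "\<exists>m n. m < n \<and> X n = X m"
    by (rule bounded_sequence_repeats) (auto intro!: U_det U_M U_mult U_adj *)
  with X show False by (auto dest: injD)
qed

lemma no_bounded_descent:
  fixes \<mu> :: "real^2^2 \<Rightarrow> real"
  assumes "T \<subseteq> U" "\<And>A. A \<in> T \<Longrightarrow> entries_le K A"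
    and "\<And>A. A \<in> T \<Longrightarrow> \<exists>B\<in>T. \<mu> B < \<mu> A"
  shows "T = {}"
proof (rule ccontr)
  assume "T \<noteq> {}"
  have "finite T" using assms(1,2) by (rule finite_bounded_subset_U)
  then obtain A where "A \<in> T" "\<And>B. B \<in> T \<Longrightarrow> \<not> \<mu> B < \<mu> A"
    using \<open>T \<noteq> {}\<close> by (metis arg_min_if_finite(1,2))
  with assms(3) show False by blast
qed

text \<open>The powers of an elliptic \<open>H\<close> are \<open>H^n = u H - v I\<close>, where consecutive coefficients
  satisfy \<open>u^2 + v^2 - t u v = 1\<close>, a positive definite form for \<open>\<bar>t\<bar> < 2\<close>.\<close>

lemma elliptic_in_U:
  assumes H: "H \<in> M" and t: "\<bar>trace H\<bar> < 2"
  shows "H \<in> U"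
proof -
  obtain p q r s where Hs: "H = mat2 p q r s" by (rule mat2_cases)
  define t where "t = p + s"
  have t2: "\<bar>t\<bar> < 2" using assms by (simp add: Hs t_def)
  have d: "p * s - q * r = 1" using det_M[OF H] by (simp add: Hs)
  define X where "X n = (((**) H) ^^ n) (mat 1)" for n
  have X0: "X 0 = mat 1" and XS: "X (Suc n) = H ** X n" for n by (simp_all add: X_def)
  have detX: "det (X n) = 1" for n
    by (induction n) (simp_all add: X0 XS det_mul det_M[OF H])
  have add: "X (m + n) = X m ** X n" for m n
    by (induction m) (simp_all add: X0 XS matrix_mul_assoc)
  have XM: "X n \<in> M" if "n > 0" for n
    using that
  proof (induction n)
    case (Suc n) then show ?case using H by (cases n) (auto simp: XS X0 intro: mult_M)
  qed simp
  have form: "\<exists>u v. X n = mat2 (u*p - v) (u*q) (u*r) (u * s - v) \<and> u\<^sup>2 + v\<^sup>2 - t*u * v = 1" for n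
  proof (induction n)
    \<comment> \<open>\<open>v\<close> is always the preceding value of \<open>u\<close>; at
      exponent 0 this is the value -1 at index -1.\<close>
    case 0 show ?case by (intro exI[of _ 0] exI[of _ "-1"]) (simp add: X0 mat2_one)
  next
    case (Suc n)
    then obtain u v where *: "X n = mat2 (u*p - v) (u*q) (u*r) (u * s - v)" "u\<^sup>2 + v\<^sup>2 - t*u * v = 1"
      by blast
    show ?case
    proof (intro exI conjI)
      show "X (Suc n) = mat2 ((t*u-v)*p - u) ((t*u-v)*q) ((t*u-v)*r) ((t*u-v) * s - u)"
        unfolding XS * Hs using d by (simp add: t_def) algebra
      show "(t*u-v)\<^sup>2 + u\<^sup>2 - t*(t*u-v) * u = 1" using *(2) by algebra
    qed
  qed
  define B where "B = 1 / (1 - \<bar>t\<bar>/2)"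
  have uv: "\<bar>u\<bar> \<le> B + 1 \<and> \<bar>v\<bar> \<le> B + 1" if "u\<^sup>2 + v\<^sup>2 - t*u * v = 1" for u v
  proof -
    have "t*u * v \<le> \<bar>t\<bar> * (\<bar>u\<bar> * \<bar>v\<bar>)" by (metis abs_ge_self abs_mult mult.assoc)
    also have "\<dots> \<le> \<bar>t\<bar> * ((u\<^sup>2 + v\<^sup>2) / 2)"
    proof (rule mult_left_mono)
      have "0 \<le> (\<bar>u\<bar> - \<bar>v\<bar>)\<^sup>2" by simp
      then show "\<bar>u\<bar> * \<bar>v\<bar> \<le> (u\<^sup>2 + v\<^sup>2) / 2" by (simp add: power2_diff)
    qed simp
    finally have "(u\<^sup>2 + v\<^sup>2) * (1 - \<bar>t\<bar>/2) \<le> 1"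
      using that by (simp only: right_diff_distrib mult_1_right times_divide_eq_right mult.commute[of "u\<^sup>2 + v\<^sup>2"])
    then have "u\<^sup>2 + v\<^sup>2 \<le> B" using t2 by (simp add: B_def field_simps)
    moreover have "\<bar>w\<bar> \<le> w\<^sup>2 + 1/4" for w :: real
      using zero_le_power2[of "\<bar>w\<bar> - 1/2"] unfolding power2_diff by (simp add: power_divide)
    note this[of u] this[of v]
    moreover have "0 \<le> u\<^sup>2" "0 \<le> v\<^sup>2" by simp_all
    ultimately show ?thesis by linarith
  qed
  define C where "C = \<bar>p\<bar> + \<bar>q\<bar> + \<bar>r\<bar> + \<bar>s\<bar> + 1"
  have "entries_le ((B + 1) * C) (X n)" for n
  proof -
    obtain u v where *: "X n = mat2 (u*p - v) (u*q) (u*r) (u * s - v)" "\<bar>u\<bar> \<le> B + 1" "\<bar>v\<bar> \<le> B + 1"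
      using form uv by metis
    have m: "\<bar>u * x\<bar> \<le> (B + 1) * \<bar>x\<bar>" for x using *(2) by (simp add: abs_mult mult_right_mono)
    have "0 \<le> (B+1) * \<bar>x\<bar>" for x using *(2) by simp
    then show ?thesis using m[of p] m[of q] m[of r] m[of s] *(2,3)
      unfolding *(1) C_def by (simp add: distrib_left) (smt (verit))
  qed
  then have "bounded (range X)"
    by (intro bounded_subset[OF bounded_entries_le[of "(B + 1) * C"]]) auto
  then have "\<exists>m n. m < n \<and> X n = X m"
  proof (rule bounded_sequence_repeats)
    fix m n :: nat assume "m < n"
    then have "X n = X (n - m) ** X m" by (simp flip: add)
    then show "X n ** adj (X m) \<in> M"
      using XM[of "n - m"] \<open>m < n\<close> by (simp add: mult_adj detX flip: matrix_mul_assoc)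
  qed (rule detX)
  then obtain m n where mn: "m < n" "X n = X m" by blast
  then have "X (n - m) ** X m = X m" by (simp flip: add)
  then have "X (n - m) ** X m ** adj (X m) = mat 1" by (simp add: mult_adj detX)
  then have one: "X (n - m) = mat 1" by (simp add: mult_adj detX flip: matrix_mul_assoc)
  define k where "k = n - m - 1"
  have k: "X (Suc k) = mat 1" using one mn by (simp add: k_def Suc_diff_Suc)
  have "adj H ** (H ** X k) = adj H" using k by (simp add: XS)
  then have Xk: "X k = adj H" by (simp add: mult_adj_cancel det_M[OF H])
  \<comment> \<open>\<open>X k\<close> is already the inverse, but \<open>k\<close> may be 0, where
    \<open>XM\<close> says nothing; the exponent \<open>2 * k + 1\<close> is positive.\<close>
  have "X (Suc (k + k)) = adj H" using add[of "Suc k" k] k Xk by simp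
  then have "adj H \<in> M" using XM[of "Suc (k + k)"] by simp
  with H show ?thesis by (simp add: U_def)
qed

text \<open>If no \<open>F^n G\<close> were elliptic, the traces of these matrices would stay positive, while the recursion
  \<open>y (n + 2) = x * y (n + 1) - y n\<close> with \<open>x < 2\<close> makes them concave, with second differences bounded
  away from \<open>0\<close>.\<close>

lemma elliptic_generator_in_U:
  assumes F: "F \<in> M" and G: "G \<in> M" and x: "\<bar>trace F\<bar> < 2"
    and \<kappa>: "fricke (trace F) (trace G) (trace (F ** G)) < 6"
  shows "G \<in> U"
proof -
  have main: "G \<in> U" if F: "F \<in> M" and G: "G \<in> M" and x: "0 \<le> trace F" "trace F < 2"
    and \<kappa>: "fricke (trace F) (trace G) (trace (F ** G)) < 6" and pos: "0 \<le> trace G" for F G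
  proof (rule ccontr)
    assume nG: "G \<notin> U"
    define x where "x = trace F"
    have x2: "0 \<le> x" "x < 2" using that by (simp_all add: x_def)
    define X where "X n = (((**) F) ^^ n) G" for n
    have X0: "X 0 = G" and XS: "X (Suc n) = F ** X n" for n by (simp_all add: X_def)
    have XM: "X n \<in> M \<and> (X n \<in> U \<longrightarrow> G \<in> U)" for n
    proof (induction n)
      case 0 then show ?case by (simp add: X0 G)
    next
      case (Suc n) then show ?case using F U_factors[of F "X n"] by (auto simp: XS intro: mult_M)
    qed
    define y where "y n = trace (X n)" for n
    have big: "\<bar>y n\<bar> \<ge> 2" for n
      using elliptic_in_U[of "X n"] XM[of n] nG by (force simp: y_def)
    have rec: "y (Suc (Suc n)) = x * y (Suc n) - y n" for n
      unfolding y_def XS x_def by (rule cayley_hamilton) (rule det_M[OF F])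
    \<comment> \<open>The recursion preserves this form, and its first value is the commutator trace
      plus \<open>2 - x\<^sup>2\<close>, below 8. A jump from at least 2 to at most -2 would make it
      at least 8, so the traces never change sign.\<close>
    have inv: "(y n)\<^sup>2 + (y (Suc n))\<^sup>2 - x * y n * y (Suc n) < 8" for n
    proof (induction n)
      case 0
      have "0 \<le> (trace F)\<^sup>2" by simp
      then show ?case using \<kappa> unfolding fricke_def y_def X0 XS x_def by linarith
    next
      case (Suc n) then show ?case unfolding rec by (simp add: power2_eq_square algebra_simps)
    qed
    have ge: "y n \<ge> 2" for n
    proof (induction n)
      case 0 then show ?case using big[of 0] pos by (simp add: y_def X0)
    next
      case (Suc n)
      show ?case
      proof (rule ccontr)
        assume "\<not> 2 \<le> y (Suc n)"
        then have s: "y (Suc n) \<le> -2" using big[of "Suc n"] by linarith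
        have "0 \<le> x * y n * (- y (Suc n))" using x2 Suc s by (intro mult_nonneg_nonneg) auto
        moreover have "2\<^sup>2 \<le> (y n)\<^sup>2" "2\<^sup>2 \<le> (- y (Suc n))\<^sup>2" using Suc s by (intro power_mono; simp)+
        ultimately show False using inv[of n] by simp
      qed
    qed
    \<comment> \<open>The second difference is \<open>(x - 2) * y (Suc n)\<close>, at most
      \<open>- e\<close> once the traces are at least 2.\<close>
    define e where "e = 2 * (2 - x)"
    have e: "e > 0" using x2 by (simp add: e_def)
    have step: "y (Suc (Suc n)) - y (Suc n) \<le> y (Suc n) - y n - e" for n
    proof -
      have "(2 - x) * 2 \<le> (2 - x) * y (Suc n)" using x2 ge by (intro mult_left_mono) auto
      then show ?thesis unfolding rec e_def by (simp add: algebra_simps)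
    qed
    have lin: "y (Suc n) - y n \<le> y 1 - y 0 - e * n" for n
    proof (induction n)
      case (Suc n) then show ?case using step[of n] by (simp add: algebra_simps)
    qed simp
    \<comment> \<open>Completing the square in the form bounds all traces at once, by way of
      \<open>1 - x\<^sup>2 / 4 \<ge> e / 4\<close>; a single sufficiently negative difference then
      contradicts positivity.\<close>
    have ub: "y n \<le> 1 + 8 / e * 4" for n
    proof -
      have "0 \<le> (y (Suc n) - x * y n / 2)\<^sup>2" by simp
      then have "(y n)\<^sup>2 * (1 - x\<^sup>2/4) \<le> 8" using inv[of n]
        by (simp add: power2_eq_square algebra_simps)
      moreover have "e / 4 \<le> 1 - x\<^sup>2/4"
      proof -
        have "x * x \<le> 2 * x" using x2 by (intro mult_right_mono) auto
        then show ?thesis by (simp add: e_def power2_eq_square field_simps)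
      qed
      then have "(y n)\<^sup>2 * (e/4) \<le> (y n)\<^sup>2 * (1 - x\<^sup>2/4)" by (intro mult_left_mono) auto
      moreover have "y n * (e/4) \<le> (y n)\<^sup>2 * (e/4)"
        using ge[of n] e by (intro mult_right_mono) (auto simp: power2_eq_square)
      ultimately have "y n * (e / 4) \<le> 8" by linarith
      then show ?thesis using e by (simp add: field_simps)
    qed
    obtain n :: nat where "(y 1 - y 0 + (1 + 8 / e * 4)) / e < n" using reals_Archimedean2 by blast
    then have "y 1 - y 0 + (1 + 8 / e * 4) < e * n" using e by (simp add: field_simps)
    then show False using lin[of n] ub[of n] ge[of "Suc n"] by linarith
  qed
  define sF where "sF = (if 0 \<le> trace F then F else - F)"
  define sG where "sG = (if 0 \<le> trace G then G else - G)"
  have "sG \<in> U"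
  proof (rule main)
    show "sF \<in> M" "sG \<in> M" using F G by (auto simp: sF_def sG_def uminus_M)
    show "0 \<le> trace sF" "trace sF < 2" "0 \<le> trace sG"
      using x by (auto simp: sF_def sG_def trace_uminus2)
    show "fricke (trace sF) (trace sG) (trace (sF ** sG)) < 6"
      using \<kappa> by (auto simp: sF_def sG_def trace_uminus2 mult_uminus2 fricke_def)
  qed
  then show ?thesis by (auto simp: sG_def U_uminus_iff split: if_splits)
qed

text \<open>A Euclidean algorithm on traces: passing from \<open>(F, G)\<close> to \<open>(F, FG)\<close> preserves the trace
  \<open>\<kappa>\<close> of the commutator and lowers the sum of the traces by at least \<open>sqrt (\<kappa> - 2)\<close>, so an
  elliptic product must eventually appear.\<close>

lemma antiparallel_in_U:
  assumes "F \<in> M" "G \<in> M" "2 \<le> trace F" "2 \<le> trace G"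
    and "2 * trace (F ** G) \<le> trace F * trace G"
    and "\<eta> > 0" "2 + \<eta>\<^sup>2 \<le> fricke (trace F) (trace G) (trace (F ** G))"
    and "fricke (trace F) (trace G) (trace (F ** G)) < 18"
    and "trace F + trace G \<le> \<eta> * real n"
  shows "F \<in> U \<and> G \<in> U"
  using assms
proof (induction n arbitrary: F G)
  case 0 then show ?case by simp
next
  case (Suc n)
  have main: "F \<in> U \<and> G \<in> U" if
    M: "F \<in> M" "G \<in> M" and x2: "2 \<le> trace F" and y2: "2 \<le> trace G"
    and anti: "2 * trace (F ** G) \<le> trace F * trace G"
    and \<kappa>: "2 + \<eta>\<^sup>2 \<le> fricke (trace F) (trace G) (trace (F ** G))"
      "fricke (trace F) (trace G) (trace (F ** G)) < 18"
    and size: "trace F + trace G \<le> \<eta> * real (Suc n)" and le: "trace F \<le> trace G" for F G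
  proof -
    define x y z where xyz: "x = trace F" "y = trace G" "z = trace (F ** G)"
    have FG: "F ** G \<in> M" using M by (rule mult_M)
    have k2: "2 < fricke x y z" using \<kappa>(1) \<open>\<eta> > 0\<close> unfolding xyz by (smt (verit) zero_less_power2)
    have z_gt: "-2 < z" using fricke_ge_18[of x y z] x2 y2 \<kappa>(2) unfolding xyz by (meson not_le)
    show ?thesis
    proof (cases "z < 2")
      case True
      then have "F ** G \<in> U" using elliptic_in_U[OF FG] z_gt xyz by simp
      then show ?thesis using U_factors M by blast
    next
      case False
      then have z2: "2 \<le> z" by simp
      \<comment> \<open>If this or the next inequality failed, the triple would be reduced as in
        \<open>fricke_reduced_le\<close>, against \<open>k2\<close>. The next one supplies the
        condition of opposite directions for \<open>(F, F ** G)\<close>, whose product has trace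
        \<open>x * z - y\<close>.\<close>
      have zy: "z < y"
      proof (rule ccontr)
        assume "\<not> z < y"
        then have "fricke x z y \<le> 2"
          using x2 y2 z2 le anti xyz by (intro fricke_reduced_le) auto
        then show False using k2 by (simp add: fricke_def algebra_simps)
      qed
      have yr: "x * z < 2 * y"
      proof (rule ccontr)
        assume "\<not> x * z < 2 * y"
        then have "fricke x y z \<le> 2"
          using x2 z2 le zy xyz by (intro fricke_reduced_le) auto
        then show False using k2 by simp
      qed
      have "2 * y \<le> z * y" using z2 y2 xyz by (intro mult_right_mono) auto
      moreover have "2 \<le> y" "x \<le> y" using y2 le xyz by simp_all
      ultimately have "2 \<le> y * z - x" unfolding mult.commute[of y z] by linarith
      then have "\<eta>\<^sup>2 \<le> (y - z)\<^sup>2"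
        using fricke_gap[of x y z] \<kappa>(1) x2 unfolding xyz by linarith
      then have gap: "\<eta> \<le> y - z" using zy by (meson power2_le_imp_le less_imp_le diff_ge_0_iff_ge)
      have z': "trace (F ** (F ** G)) = x * z - y"
        unfolding xyz by (rule cayley_hamilton) (rule det_M[OF M(1)])
      have "F \<in> U \<and> F ** G \<in> U"
      proof (rule Suc.IH)
        show "2 * trace (F ** (F ** G)) \<le> trace F * trace (F ** G)"
          unfolding z' using yr by (simp add: xyz)
        have "fricke (trace F) (trace (F ** G)) (trace (F ** (F ** G))) = fricke x y z"
          unfolding z' unfolding xyz[symmetric] fricke_def
          by (simp add: power2_eq_square algebra_simps)
        then show "2 + \<eta>\<^sup>2 \<le> fricke (trace F) (trace (F ** G)) (trace (F ** (F ** G)))"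
          "fricke (trace F) (trace (F ** G)) (trace (F ** (F ** G))) < 18"
          using \<kappa> xyz by simp_all
        show "trace F + trace (F ** G) \<le> \<eta> * real n"
          using size gap xyz by (simp add: algebra_simps)
      qed (use M FG x2 z2 xyz \<open>\<eta> > 0\<close> in auto)
      then show ?thesis using U_factors M by blast
    qed
  qed
  show ?case
  proof (cases "trace F \<le> trace G")
    case True
    then show ?thesis using main[of F G] Suc.prems by simp
  next
    case False
    have "trace (G ** F) = trace (F ** G)" by (rule trace_mul_sym)
    then show ?thesis using main[of G F] Suc.prems False
      by (simp add: fricke_def algebra_simps)
  qed
qed

end

subsection \<open>The descent of Joergensen\<close>

lemma mult_self_less: 
  fixes x y :: real
  assumes "x \<noteq> 0" "\<bar>y\<bar> < 1" shows "\<bar>x * y\<bar> < \<bar>x\<bar>"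
  using assms by (simp add: abs_mult)

context semidiscrete_matrices
begin

lemma U_conj: "A \<in> U \<Longrightarrow> B \<in> U \<Longrightarrow> A ** B ** adj A \<in> U"
  by (intro U_mult U_adj)

text \<open>Shimizu's descent: conjugating the translation by a matrix replaces the lower left entry
  \<open>c\<close> by \<open>- (c\<^sup>2 * t)\<close>, so \<open>\<bar>c * t\<bar>\<close> is
  squared. The entry shrinks for ever without vanishing, while the matrices stay bounded.\<close>

lemma joergensen_parabolic:
  assumes N: "mat2 1 t 0 1 \<in> U" and "t \<noteq> 0" and G: "mat2 a b c d \<in> U" and small: "(c * t)\<^sup>2 < 1"
  shows "c = 0"
proof (rule ccontr)
  assume c: "c \<noteq> 0"
  have t: "\<bar>c * t\<bar> < 1" using small by (simp add: abs_square_less_1)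
  define \<rho> where "\<rho> = \<bar>c * t\<bar>"
  \<comment> \<open>The top left entry evolves by \<open>a \<mapsto> 1 - a * c * t\<close>; since
    \<open>1 + \<rho> * K \<le> K\<close>, it never leaves the interval from \<open>- K\<close> to
    \<open>K\<close>.\<close>
  define K where "K = \<bar>a\<bar> + 1 / (1 - \<rho>)"
  have K: "1 + \<rho> * K \<le> K" "0 \<le> K" "\<bar>a\<bar> \<le> K" "0 \<le> \<rho>"
  proof -
    have "0 \<le> \<rho>" "\<rho> < 1" using t by (simp_all add: \<rho>_def)
    moreover from this have "(1 - \<rho>) * K = (1 - \<rho>) * \<bar>a\<bar> + 1" by (simp add: K_def field_simps)
    moreover have "0 \<le> (1 - \<rho>) * \<bar>a\<bar>" using \<open>\<rho> < 1\<close> by simp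
    ultimately have "1 \<le> (1 - \<rho>) * K" by simp
    then show "1 + \<rho> * K \<le> K" by (simp add: left_diff_distrib)
    show "0 \<le> K" "\<bar>a\<bar> \<le> K" "0 \<le> \<rho>"
      using \<open>0 \<le> \<rho>\<close> \<open>\<rho> < 1\<close> by (simp_all add: K_def)
  qed
  define step where "step A = A ** mat2 1 t 0 1 ** adj A" for A
  have step: "step (mat2 a b c d) = mat2 (1 - a*c*t) (a\<^sup>2*t) (- (c\<^sup>2*t)) (1 + a*c*t)"
    if "mat2 a b c d \<in> U" for a b c d
    using U_det[OF that] by (simp add: step_def power2_eq_square algebra_simps)
  define T where "T = {A \<in> U. A$2$1 \<noteq> 0 \<and> \<bar>A$2$1 * t\<bar> \<le> \<rho> \<and> \<bar>A$1$1\<bar> \<le> K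
      \<and> \<bar>A$2$1\<bar> \<le> \<bar>c\<bar> \<and> \<bar>A$1$2\<bar> \<le> K\<^sup>2 * \<bar>t\<bar> \<and> \<bar>A$2$2\<bar> \<le> 1 + K}"
  have stepT: "step (mat2 a' b' c' d') \<in> T \<and> \<bar>step (mat2 a' b' c' d') $ 2 $ 1\<bar> < \<bar>c'\<bar>"
    if A: "mat2 a' b' c' d' \<in> U" and c': "c' \<noteq> 0" "\<bar>c' * t\<bar> \<le> \<rho>" "\<bar>c'\<bar> \<le> \<bar>c\<bar>" and a': "\<bar>a'\<bar> \<le> K" 
    for a' b' c' d'
  proof -
    have less: "\<bar>c' * (c' * t)\<bar> < \<bar>c'\<bar>" using c' t by (intro mult_self_less) (auto simp: \<rho>_def)
    have "\<bar>a' * (c' * t)\<bar> \<le> K * \<rho>" unfolding abs_mult[of a'] using c' a' K by (intro mult_mono) auto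
    then have ab: "\<bar>a' * c' * t\<bar> \<le> K - 1" using K(1) by (simp add: algebra_simps)
    have ad: "\<bar>1 - a' * c' * t\<bar> \<le> K" "\<bar>1 + a' * c' * t\<bar> \<le> 1 + K" using ab by linarith+
    have c2: "\<bar>c'\<^sup>2 * t\<bar> < \<bar>c'\<bar>" using less by (simp add: power2_eq_square mult.assoc)
    have "\<bar>c'\<^sup>2 * t * t\<bar> = \<bar>c' * t\<bar> * \<bar>c' * t\<bar>" by (simp add: abs_mult power2_eq_square)
    also have "\<dots> \<le> \<rho> * 1" using c' t by (intro mult_mono) (auto simp: \<rho>_def)
    finally have c3: "\<bar>c'\<^sup>2 * t * t\<bar> \<le> \<rho>" by simp
    have a2: "\<bar>a'\<^sup>2 * t\<bar> \<le> K\<^sup>2 * \<bar>t\<bar>"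
      unfolding abs_mult using power_mono[OF a', of 2] by (intro mult_right_mono) auto
    have "step (mat2 a' b' c' d') \<in> U" unfolding step_def by (rule U_conj[OF A N])
    then show ?thesis using c2 c3 a2 ad c' \<open>t \<noteq> 0\<close> unfolding T_def step[OF A] by auto
  qed
  have "T = {}"
  proof (rule no_bounded_descent[where \<mu> = "\<lambda>A. \<bar>A$2$1\<bar>"])
    show "T \<subseteq> U" by (auto simp: T_def)
    show "entries_le (K + \<bar>c\<bar> + K\<^sup>2 * \<bar>t\<bar> + (1 + K)) A" if "A \<in> T" for A
    proof (cases A rule: mat2_cases)
      case (1 a b c d)
      have "0 \<le> K\<^sup>2 * \<bar>t\<bar>" by simp
      then show ?thesis using that K unfolding 1 T_def by simp linarith
    qed
    show "\<exists>B\<in>T. \<bar>B$2$1\<bar> < \<bar>A$2$1\<bar>" if "A \<in> T" for A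
    proof (cases A rule: mat2_cases)
      case (1 a' b' c' d')
      have "step A \<in> T \<and> \<bar>step A $ 2 $ 1\<bar> < \<bar>c'\<bar>"
        using that unfolding 1 by (intro stepT) (auto simp: T_def)
      then show ?thesis using 1 by auto
    qed
  qed
  \<comment> \<open>The bounds on the right column in \<open>T\<close> are guaranteed only for
    images under \<open>step\<close>, so the descent starts at the first image.\<close>
  moreover have "step (mat2 a b c d) \<in> T" using stepT[OF G] c K by (simp add: \<rho>_def)
  ultimately show False by blast
qed

text \<open>The quantity \<open>\<nu>\<close> vanishes exactly on the matrices that commute with the
  rotation, and \<open>4 * \<nu> + 2\<close> is the sum of the squares of the entries. Conjugating
  the rotation by \<open>A\<close> turns \<open>\<nu>\<close> into
  \<open>4 * s\<^sup>2 * \<nu> * (1 + \<nu>)\<close>, which the smallness assumption makes a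
  decrease.\<close>

lemma joergensen_elliptic:
  assumes N: "mat2 k (-s) s k \<in> U" and s: "s \<noteq> 0" and G: "mat2 a b c d \<in> U"
    and small: "4 * s\<^sup>2 * (1 + ((a - d)\<^sup>2 + (b + c)\<^sup>2) / 4) < 1"
  shows "a = d \<and> c = - b"
proof (rule ccontr)
  assume nz: "\<not> (a = d \<and> c = - b)"
  define \<nu> where "\<nu> A = ((A$1$1 - A$2$2)\<^sup>2 + (A$1$2 + A$2$1)\<^sup>2) / 4" for A :: "real^2^2"
  have \<nu>_nonneg: "0 \<le> \<nu> A" for A by (simp add: \<nu>_def)
  have ks: "k\<^sup>2 + s\<^sup>2 = 1" using U_det[OF N] by (simp add: power2_eq_square)
  define step where "step A = A ** mat2 k (-s) s k ** adj A" for A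
  have \<nu>_step: "\<nu> (step A) = 4 * s\<^sup>2 * \<nu> A * (1 + \<nu> A)" if "A \<in> U" for A
  proof (cases A rule: mat2_cases)
    case (1 a b c d)
    have "a * d - b * c = 1" using U_det[OF that] by (simp add: 1)
    then show ?thesis unfolding step_def 1 \<nu>_def using ks by (simp add: field_simps) algebra
  qed
  define T where "T = {A \<in> U. 0 < \<nu> A \<and> 4 * s\<^sup>2 * (1 + \<nu> A) < 1 \<and> \<nu> A \<le> \<nu> (mat2 a b c d)}"
  have "T = {}"
  proof (rule no_bounded_descent[where \<mu> = \<nu>])
    show "T \<subseteq> U" by (auto simp: T_def)
    show "entries_le (4 * \<nu> (mat2 a b c d) + 3) A" if "A \<in> T" for A
    proof (cases A rule: mat2_cases)
      case (1 a' b' c' d')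
      have "a' * d' - b' * c' = 1" using that U_det[of A] by (simp add: T_def 1)
      then have "a'\<^sup>2 + b'\<^sup>2 + c'\<^sup>2 + d'\<^sup>2 = 4 * \<nu> A + 2"
        unfolding 1 \<nu>_def by (simp add: power2_eq_square field_simps)
      then have le: "a'\<^sup>2 + b'\<^sup>2 + c'\<^sup>2 + d'\<^sup>2 \<le> 4 * \<nu> (mat2 a b c d) + 2"
        using that by (simp add: T_def)
      have ab: "\<bar>w\<bar> \<le> w\<^sup>2 + 1/4" for w :: real
        using zero_le_power2[of "\<bar>w\<bar> - 1/2"] unfolding power2_diff by (simp add: power_divide)
      show ?thesis using le ab[of a'] ab[of b'] ab[of c'] ab[of d'] 
          zero_le_power2[of a'] zero_le_power2[of b'] zero_le_power2[of c'] zero_le_power2[of d']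
        unfolding 1 entries_le_mat2 by linarith
    qed
    show "\<exists>B\<in>T. \<nu> B < \<nu> A" if "A \<in> T" for A
    proof (rule bexI[of _ "step A"])
      have A: "A \<in> U" "0 < \<nu> A" "4 * s\<^sup>2 * (1 + \<nu> A) < 1" "\<nu> A \<le> \<nu> (mat2 a b c d)"
        using that by (simp_all add: T_def)
      have "\<nu> (step A) = \<nu> A * (4 * s\<^sup>2 * (1 + \<nu> A))" by (simp add: \<nu>_step[OF A(1)])
      also have "\<dots> < \<nu> A * 1" using A by (intro mult_strict_left_mono)
      finally show less: "\<nu> (step A) < \<nu> A" by simp
      have "0 < \<nu> (step A)" using A(2) s by (simp add: \<nu>_step[OF A(1)])
      moreover have "4 * s\<^sup>2 * (1 + \<nu> (step A)) \<le> 4 * s\<^sup>2 * (1 + \<nu> A)"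
        using less by (intro mult_left_mono) auto
      moreover have "step A \<in> U" unfolding step_def by (rule U_conj[OF A(1) N])
      ultimately show "step A \<in> T" using A less by (auto simp: T_def)
    qed
  qed
  moreover have "mat2 a b c d \<in> T"
  proof -
    have "0 < \<nu> (mat2 a b c d)"
      using nz by (auto simp: \<nu>_def sum_power2_gt_zero_iff eq_neg_iff_add_eq_0 add.commute)
    moreover have "4 * s\<^sup>2 * (1 + \<nu> (mat2 a b c d)) < 1" using small by (simp add: \<nu>_def)
    ultimately show ?thesis using G by (simp add: T_def)
  qed
  ultimately show False by blast
qed

section \<open>Groups containing a hyperbolic diagonal matrix\<close>

context
  fixes u :: real
  assumes u: "1 < u" and N: "mat2 u 0 0 (1/u) \<in> U"
begin

lemma conj_diag:
  assumes "mat2 a b c d \<in> U"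
  shows "mat2 a (b * u ^ (2*n)) (c / u ^ (2*n)) d \<in> U" "mat2 a (b / u ^ (2*n)) (c * u ^ (2*n)) d \<in> U"
proof (induction n)
  case (Suc n)
  { case 1
    have "mat2 u 0 0 (1/u) ** mat2 a (b * u ^ (2*n)) (c / u ^ (2*n)) d ** adj (mat2 u 0 0 (1/u)) \<in> U"
      by (intro U_conj N Suc)
    then show ?case using u by (simp add: field_simps power2_eq_square) }
  { case 2
    have "adj (mat2 u 0 0 (1/u)) ** mat2 a (b / u ^ (2*n)) (c * u ^ (2*n)) d ** adj (adj (mat2 u 0 0 (1/u))) \<in> U"
      by (intro U_conj U_adj N Suc)
    then show ?case using u by (simp add: field_simps power2_eq_square) }
qed (use assms in simp_all)

lemma inj_real_powers:
  assumes "t \<noteq> 0" shows "inj (\<lambda>n. t / u ^ (2*n))"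
proof (rule injI)
  fix m n assume "t / u ^ (2*m) = t / u ^ (2*n)"
  then have "u ^ (2*m) = u ^ (2*n)" using assms u by (simp add: field_simps)
  then show "m = n" using u power_inject_exp[of u "2*m" "2*n"] by simp
qed

lemma quotient_le: "\<bar>t / u ^ k\<bar> \<le> \<bar>t\<bar>"
proof -
  have "\<bar>t\<bar> * 1 \<le> \<bar>t\<bar> * u ^ k" using u by (intro mult_left_mono) auto
  then show ?thesis using u by (simp add: abs_div field_simps)
qed

text \<open>Two elements of a discrete group, one of them hyperbolic, cannot share exactly one fixed point.\<close>

lemma shared_fixed_point:
  assumes H: "mat2 a b c d \<in> U" and "b * c = 0"
  shows "b = 0 \<and> c = 0"
proof (rule ccontr)
  \<comment> \<open>Conjugation by powers of the diagonal matrix, in the direction that shrinks the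
    nonzero off-diagonal entry, gives infinitely many elements within a bounded set.\<close>
  define T where "T = (if c = 0 then range (\<lambda>n. mat2 a (b / u ^ (2*n)) 0 d)
    else range (\<lambda>n. mat2 a 0 (c / u ^ (2*n)) d))"
  assume "\<not> (b = 0 \<and> c = 0)"
  then have "infinite T"
    using assms(2) inj_real_powers[of b] inj_real_powers[of c]
    by (auto simp: T_def inj_on_def intro!: range_inj_infinite)
  moreover have "finite T"
  proof (rule finite_bounded_subset_U)
    show "T \<subseteq> U"
      using conj_diag[OF H] assms(2) by (auto simp: T_def)
    show "entries_le (\<bar>a\<bar> + \<bar>b\<bar> + \<bar>c\<bar> + \<bar>d\<bar>) A" if "A \<in> T" for A
    proof -
      obtain n where "A = mat2 a (b / u ^ (2*n)) 0 d \<or> A = mat2 a 0 (c / u ^ (2*n)) d"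
        using \<open>A \<in> T\<close> by (auto simp: T_def split: if_splits)
      then show ?thesis using quotient_le[of b "2*n"] quotient_le[of c "2*n"] by auto
    qed
  qed
  ultimately show False by blast
qed

text \<open>Raising \<open>n\<close> by one multiplies the ratio of \<open>y * u ^ (2*n)\<close> to
  \<open>x / u ^ (2*n)\<close> by \<open>u ^ 4\<close>; the last \<open>n\<close> at which this
  ratio is at most 1 serves.\<close>

lemma balance_aux:
  assumes "0 < y" "y \<le> x"
  shows "\<exists>n. x / u ^ (2*n) \<le> u ^ 4 * (y * u ^ (2*n)) \<and> y * u ^ (2*n) \<le> u ^ 4 * (x / u ^ (2*n))"
proof -
  define P where "P n \<longleftrightarrow> x < y * u ^ (4*n)" for n
  have "1 < u ^ 4" using u by simp
  then obtain m where "x / y < (u ^ 4) ^ m" using real_arch_pow by blast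
  then have "P m" using assms by (simp only: P_def power_mult pos_divide_less_eq mult.commute[of y])
  define l where "l = (LEAST n. P n)"
  have l: "P l" unfolding l_def using \<open>P m\<close> by (rule LeastI)
  have "l \<noteq> 0" using l assms by (auto simp: P_def intro!: gr0I)
  then obtain n where n: "l = Suc n" by (cases l) auto
  have "\<not> P n" using not_less_Least[of n P] n unfolding l_def by simp
  then have n1: "y * u ^ (4*n) \<le> x" by (simp add: P_def)
  have n2: "x < u ^ 4 * (y * u ^ (4*n))" using l by (simp add: P_def n power_add mult_ac)
  have e: "u ^ (4*n) = u ^ (2*n) * u ^ (2*n)" by (simp flip: power_add)
  have p: "0 < u ^ (2*n)" using u by simp
  have "x / u ^ (2*n) \<le> u ^ 4 * (y * u ^ (2*n))"
    using n2 p unfolding e by (simp add: field_simps)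
  moreover have "y * u ^ (2*n) \<le> x / u ^ (2*n)" using n1 p unfolding e by (simp add: field_simps)
  moreover have "x / u ^ (2*n) \<le> u ^ 4 * (x / u ^ (2*n))"
    using mult_right_mono[of 1 "u^4" "x / u ^ (2*n)"] u p assms by simp
  ultimately show ?thesis by (intro exI[of _ n]) auto
qed

text \<open>The descent on \<open>b * c\<close> leaves the ratio of \<open>b\<close> and \<open>c\<close> uncontrolled; conjugation by powers of the
  diagonal matrix restores boundedness.\<close>

lemma balance:
  assumes H: "mat2 a b c d \<in> U" and bc: "b * c \<noteq> 0"
  obtains b' c' where "mat2 a b' c' d \<in> U" "b' * c' = b * c" "\<bar>b'\<bar> \<le> u ^ 4 * \<bar>c'\<bar>" "\<bar>c'\<bar> \<le> u ^ 4 * \<bar>b'\<bar>"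
proof (cases "\<bar>c\<bar> \<le> \<bar>b\<bar>")
  case True
  then obtain n where "\<bar>b\<bar> / u ^ (2*n) \<le> u ^ 4 * (\<bar>c\<bar> * u ^ (2*n))"
    "\<bar>c\<bar> * u ^ (2*n) \<le> u ^ 4 * (\<bar>b\<bar> / u ^ (2*n))"
    using balance_aux[of "\<bar>c\<bar>" "\<bar>b\<bar>"] bc by auto
  then show ?thesis using u
    by (intro that[OF conj_diag(2)[OF H, of n]]) (simp_all add: abs_mult)
next
  case False
  then obtain n where "\<bar>c\<bar> / u ^ (2*n) \<le> u ^ 4 * (\<bar>b\<bar> * u ^ (2*n))"
    "\<bar>b\<bar> * u ^ (2*n) \<le> u ^ 4 * (\<bar>c\<bar> / u ^ (2*n))"
    using balance_aux[of "\<bar>b\<bar>" "\<bar>c\<bar>"] bc by auto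
  then show ?thesis using u
    by (intro that[OF conj_diag(1)[OF H, of n]]) (simp_all add: abs_mult)
qed

text \<open>Conjugating the diagonal matrix turns \<open>\<beta> = b * c\<close> into
  \<open>- (w\<^sup>2 * \<beta> * (1 + \<beta>))\<close>, smaller in modulus by assumption. By
  \<open>shared_fixed_point\<close> it becomes 0 only if \<open>a = d = 0\<close>, and
  \<open>balance\<close> keeps the entries bounded.\<close>

lemma joergensen_hyperbolic:
  assumes G: "mat2 a b c d \<in> U" and small: "(u - 1/u)\<^sup>2 * (1 + \<bar>b * c\<bar>) < 1"
  shows "(b = 0 \<and> c = 0) \<or> (a = 0 \<and> d = 0)"
proof (rule ccontr)
  assume nz: "\<not> ?thesis"
  define w where "w = u - 1/u"
  define \<tau> where "\<tau> = u + 1/u"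
  have w: "w > 0" using u less_1_mult[of u u] by (simp add: w_def field_simps) 
  have \<tau>: "\<tau> > 0" using u by (simp add: \<tau>_def add_pos_pos)
  define \<beta> where "\<beta> A = A$1$2 * A$2$1" for A :: "real^2^2"
  \<comment> \<open>Every image of a step is conjugate to the diagonal matrix, so it has trace
    \<open>\<tau> > 0\<close>, which excludes \<open>a = d = 0\<close> from then on. The last two
    conditions come from \<open>balance\<close>.\<close>
  define T where "T = {A \<in> U. trace A = \<tau> \<and> \<beta> A \<noteq> 0 \<and> w\<^sup>2 * (1 + \<bar>\<beta> A\<bar>) < 1 \<and> \<bar>\<beta> A\<bar> \<le> \<bar>b * c\<bar>
     \<and> \<bar>A$1$2\<bar> \<le> u ^ 4 * \<bar>A$2$1\<bar> \<and> \<bar>A$2$1\<bar> \<le> u ^ 4 * \<bar>A$1$2\<bar>}"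
  have step: "\<exists>B\<in>T. \<bar>\<beta> B\<bar> < \<bar>b' * c'\<bar>"
    if A: "mat2 a' b' c' d' \<in> U" and bc: "b' * c' \<noteq> 0" and ad: "a' \<noteq> 0 \<or> d' \<noteq> 0"
      and sm: "w\<^sup>2 * (1 + \<bar>b' * c'\<bar>) < 1" and le: "\<bar>b' * c'\<bar> \<le> \<bar>b * c\<bar>" for a' b' c' d'
  proof -
    have d: "a' * d' - b' * c' = 1" using U_det[OF A] by simp
    define B where "B = mat2 (a'*d'*u - b'*c'/u) (- (a'*b'*w)) (c'*d'*w) (a'*d'/u - b'*c'*u)"
    have "mat2 a' b' c' d' ** mat2 u 0 0 (1/u) ** adj (mat2 a' b' c' d') = B"
      using u by (simp add: B_def w_def field_simps)
    then have BU: "B \<in> U" using U_conj[OF A N] by simp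
    have nz: "- (a'*b'*w) * (c'*d'*w) \<noteq> 0"
    proof
      assume "- (a'*b'*w) * (c'*d'*w) = 0"
      then have "- (a'*b'*w) = 0 \<and> c'*d'*w = 0" by (rule shared_fixed_point[OF BU[unfolded B_def]])
      moreover have "b' \<noteq> 0" "c' \<noteq> 0" "w \<noteq> 0" using bc w by auto
      ultimately show False using ad by simp
    qed
    have "\<bar>(- (a'*b'*w)) * (c'*d'*w)\<bar> = \<bar>b' * c'\<bar> * (w\<^sup>2 * \<bar>a' * d'\<bar>)"
      by (simp add: abs_mult power2_eq_square)
    also have "a' * d' = 1 + b' * c'" using d by simp
    also have "\<bar>b' * c'\<bar> * (w\<^sup>2 * \<bar>1 + b' * c'\<bar>) \<le> \<bar>b' * c'\<bar> * (w\<^sup>2 * (1 + \<bar>b' * c'\<bar>))"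
      by (intro mult_left_mono) auto
    also have "\<dots> < \<bar>b' * c'\<bar> * 1" using sm bc by (intro mult_strict_left_mono) auto
    finally have less: "\<bar>(- (a'*b'*w)) * (c'*d'*w)\<bar> < \<bar>b' * c'\<bar>" by simp
    obtain e f where ef: "mat2 (a'*d'*u - b'*c'/u) e f (a'*d'/u - b'*c'*u) \<in> U"
        "e * f = (- (a'*b'*w)) * (c'*d'*w)" "\<bar>e\<bar> \<le> u ^ 4 * \<bar>f\<bar>" "\<bar>f\<bar> \<le> u ^ 4 * \<bar>e\<bar>"
      using balance[OF BU[unfolded B_def] nz] by metis
    have "(a'*d'*u - b'*c'/u) + (a'*d'/u - b'*c'*u) = \<tau> * (a' * d' - b' * c')"
      by (simp add: \<tau>_def algebra_simps)
    then have tr: "(a'*d'*u - b'*c'/u) + (a'*d'/u - b'*c'*u) = \<tau>" using d by simp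
    have "w\<^sup>2 * (1 + \<bar>e * f\<bar>) \<le> w\<^sup>2 * (1 + \<bar>b' * c'\<bar>)"
      unfolding ef(2) using less by (intro mult_left_mono) auto
    then have sm': "w\<^sup>2 * (1 + \<bar>e * f\<bar>) < 1" using sm by linarith
    have "e * f \<noteq> 0" using nz ef(2) by simp
    then have ef0: "e \<noteq> 0" "f \<noteq> 0" by auto
    show ?thesis
      using ef ef0 tr less sm' le[THEN order.strict_trans2[OF less]]
      by (intro bexI[of _ "mat2 (a'*d'*u - b'*c'/u) e f (a'*d'/u - b'*c'*u)"])
        (simp_all add: T_def \<beta>_def)
  qed
  have "T = {}"
  proof (rule no_bounded_descent[where \<mu> = "\<lambda>A. \<bar>\<beta> A\<bar>"])
    show "T \<subseteq> U" by (auto simp: T_def)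
    show "entries_le (\<tau>\<^sup>2 + 2 * \<bar>b*c\<bar> + u ^ 4 * \<bar>b*c\<bar> + 1) A" if "A \<in> T" for A
    proof (cases A rule: mat2_cases)
      case (1 a' b' c' d')
      have A: "a' * d' - b' * c' = 1" "a' + d' = \<tau>" "\<bar>b' * c'\<bar> \<le> \<bar>b * c\<bar>"
          "\<bar>b'\<bar> \<le> u ^ 4 * \<bar>c'\<bar>" "\<bar>c'\<bar> \<le> u ^ 4 * \<bar>b'\<bar>"
        using that U_det[of A] by (auto simp: T_def 1 \<beta>_def)
      have "a'\<^sup>2 + d'\<^sup>2 = (a' + d')\<^sup>2 - 2 * (a' * d' - b' * c') - 2 * (b' * c')"
        by (simp add: power2_eq_square algebra_simps)
      then have ad: "a'\<^sup>2 + d'\<^sup>2 \<le> \<tau>\<^sup>2 + 2 * \<bar>b*c\<bar>" using A by simp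
      have ab: "\<bar>w\<bar> \<le> w\<^sup>2 + 1" for w :: real
        using zero_le_power2[of "\<bar>w\<bar> - 1/2"] unfolding power2_diff by (simp add: power_divide)
      have ub: "u ^ 4 * \<bar>b' * c'\<bar> \<le> u ^ 4 * \<bar>b * c\<bar>" using u A by (intro mult_left_mono) auto
      have "\<bar>b'\<bar> * \<bar>b'\<bar> \<le> u ^ 4 * \<bar>c'\<bar> * \<bar>b'\<bar>" "\<bar>c'\<bar> * \<bar>c'\<bar> \<le> u ^ 4 * \<bar>b'\<bar> * \<bar>c'\<bar>"
        using A by (intro mult_right_mono; simp)+
      then have "b'\<^sup>2 \<le> u ^ 4 * \<bar>b * c\<bar>" "c'\<^sup>2 \<le> u ^ 4 * \<bar>b * c\<bar>"
        using ub by (simp_all add: power2_eq_square abs_mult mult_ac)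
      moreover have "0 \<le> u ^ 4 * \<bar>b * c\<bar>" "0 \<le> \<tau>\<^sup>2" using u by simp_all
      ultimately show ?thesis 
        using ad ab[of a'] ab[of b'] ab[of c'] ab[of d'] zero_le_power2[of a'] zero_le_power2[of d']
        unfolding 1 entries_le_mat2 by linarith
    qed
    show "\<exists>B\<in>T. \<bar>\<beta> B\<bar> < \<bar>\<beta> A\<bar>" if "A \<in> T" for A
    proof (cases A rule: mat2_cases)
      case (1 a' b' c' d')
      have "a' \<noteq> 0 \<or> d' \<noteq> 0" using that \<tau> by (auto simp: T_def 1)
      then show ?thesis using that step[of a' b' c' d'] by (simp add: T_def 1 \<beta>_def)
    qed
  qed
  moreover have "b * c \<noteq> 0" using shared_fixed_point[OF G] nz by blast
  then have "T \<noteq> {}" using step[OF G] nz small by (auto simp: w_def)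
  ultimately show False by blast
qed

end

end

subsection \<open>Normal forms and invariant cones\<close>

text \<open>With \<open>det P > 0\<close> the matrix \<open>P\<close> acts on the half-plane, so
  fixed points can be transported along it. Nonnegative trace excludes the forms with negative real
  eigenvalues.\<close>

lemma SL2_normal_form:
  assumes det: "det A = 1" and tr: "0 \<le> trace A" and ne: "A \<noteq> mat 1"
  obtains (hyperbolic) P u where "det P > 0" "u > 1" "A ** P = P ** mat2 u 0 0 (1/u)"
  | (parabolic) P t where "det P > 0" "t \<noteq> 0" "A ** P = P ** mat2 1 t 0 1"
  | (elliptic) P k s where "det P > 0" "s \<noteq> 0" "k\<^sup>2 + s\<^sup>2 = 1" "A ** P = P ** mat2 k (-s) s k"
proof -
  obtain p q r s where A: "A = mat2 p q r s" by (rule mat2_cases)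
  have d: "p * s - q * r = 1" using det by (simp add: A)
  have tr0: "0 \<le> p + s" using tr by (simp add: A)
  consider "p + s < 2" | "p + s = 2" | "p + s > 2" by linarith
  then show thesis
  proof cases
    case 1
    \<comment> \<open>The fixed point of \<open>A\<close> in the upper half-plane is
      \<open>(p - s) / (2 * r) + \<i> * \<sigma> / r\<close>; the factor \<open>sgn r\<close> makes
      its imaginary part positive. The conjugating matrix sends \<open>\<i>\<close> to it.\<close>
    define \<sigma> where "\<sigma> = sgn r * sqrt (1 - ((p + s) / 2)\<^sup>2)"
    have "((p + s) / 2)\<^sup>2 < 1\<^sup>2" using 1 tr0 by (intro power_strict_mono) auto
    then have pos: "1 - ((p + s) / 2)\<^sup>2 > 0" by simp
    have r: "r \<noteq> 0"
    proof
      assume "r = 0"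
      then have "p * s = 1" using d by simp
      then have "((p + s) / 2)\<^sup>2 = 1 + ((p - s) / 2)\<^sup>2" by (simp add: power2_eq_square field_simps)
      then show False using pos by (smt (verit) zero_le_power2)
    qed
    have "(sgn r)\<^sup>2 = 1" using r by (simp add: sgn_if)
    then have \<sigma>: "\<sigma>\<^sup>2 = 1 - ((p + s) / 2)\<^sup>2" "\<sigma> \<noteq> 0" "\<sigma> / r > 0"
      using pos r by (auto simp: \<sigma>_def power_mult_distrib sgn_if zero_less_divide_iff divide_less_0_iff)
    show thesis
    proof (rule elliptic)
      show "det (mat2 (\<sigma> / r) ((p - s) / (2 * r)) 0 1) > 0" using \<sigma> by simp
      show "((p + s) / 2)\<^sup>2 + \<sigma>\<^sup>2 = 1" using \<sigma> by simp
      define k h where "k = (p + s) / 2" and "h = (p - s) / 2"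
      have ps: "p = k + h" "s = k - h" by (simp_all add: k_def h_def field_simps)
      have "q * r = - (\<sigma>\<^sup>2 + h\<^sup>2)"
        using \<sigma>(1) d by (simp add: ps power2_eq_square field_simps)
      then have "q = - (\<sigma>\<^sup>2 + h\<^sup>2) / r" using r by (simp add: field_simps)
      then show "A ** mat2 (\<sigma> / r) ((p - s) / (2 * r)) 0 1 =
          mat2 (\<sigma> / r) ((p - s) / (2 * r)) 0 1 ** mat2 ((p + s) / 2) (- \<sigma>) \<sigma> ((p + s) / 2)"
        using r by (simp add: A ps power2_eq_square field_simps)
    qed (rule \<sigma>)
  next
    case 2
    then have s: "s = 2 - p" by simp
    have qr: "q * r = - (p - 1)\<^sup>2" using d by (simp add: s power2_eq_square algebra_simps)
    show thesis
    proof (cases "r = 0")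
      case True
      then have "p = 1" using qr by simp
      then have "q \<noteq> 0" using ne True s by (auto simp: A mat2_one)
      then show thesis using \<open>p = 1\<close> True s
        by (intro parabolic[of "mat2 1 0 0 1" q]) (simp_all add: A)
    next
      case False
      then have "q = - (p - 1)\<^sup>2 / r" using qr by (simp add: field_simps)
      then have "A ** mat2 (p - 1) (-1/r) r 0 = mat2 (p - 1) (-1/r) r 0 ** mat2 1 (-1/r) 0 1"
        unfolding A s using False by (simp add: power2_eq_square field_simps)
      then show thesis using False
        by (intro parabolic[of "mat2 (p - 1) (-1/r) r 0" "-1/r"]) simp_all
    qed
  next
    case 3
    define D where "D = sqrt ((p + s)\<^sup>2 - 4)"
    define u where "u = (p + s + D) / 2"
    have "2\<^sup>2 < (p + s)\<^sup>2" using 3 by (intro power_strict_mono) auto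
    then have D: "D > 0" "D\<^sup>2 = (p + s)\<^sup>2 - 4" by (simp_all add: D_def)
    have u1: "u > 1" using 3 D by (simp add: u_def)
    have quad: "u * u = (p + s) * u - 1"
      using D(2) by (simp add: u_def power2_eq_square field_simps)
    have uinv: "1 / u = p + s - u" using quad u1 by (simp add: field_simps)
    have e: "(p - u) * (s - u) = q * r" using quad d by (simp add: algebra_simps)
    have D': "p + s - 2 * u = - D" by (simp add: u_def field_simps)
    obtain P where P: "det P \<noteq> 0" "A ** P = P ** mat2 u 0 0 (1/u)"
    proof (cases "r = 0 \<and> q = 0")
      case True
      then have "p = u \<or> s = u" using e by auto
      then show thesis
      proof
        assume "p = u" then show thesis
          using that[of "mat2 1 0 0 1"] True by (simp add: A uinv)
      next
        assume "s = u" then show thesis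
          using that[of "mat2 0 1 1 0"] True by (simp add: A uinv)
      qed
    next
      case False
      show thesis
      proof (cases "r = 0")
        case True
        then have "q \<noteq> 0" using False by simp
        show thesis
        proof (rule that)
          show "det (mat2 q q (u - p) (s - u)) \<noteq> 0"
            using D' D \<open>q \<noteq> 0\<close> by (simp flip: right_diff_distrib) 
          show "A ** mat2 q q (u - p) (s - u) = mat2 q q (u - p) (s - u) ** mat2 u 0 0 (1 / u)"
            unfolding uinv using e True by (simp add: A algebra_simps)
        qed
      next
        case False
        show thesis
        proof (rule that)
          show "det (mat2 (u - s) (p - u) r r) \<noteq> 0"
            using D' D False by (simp flip: left_diff_distrib)
          show "A ** mat2 (u - s) (p - u) r r = mat2 (u - s) (p - u) r r ** mat2 u 0 0 (1 / u)"
            unfolding uinv using e by (simp add: A algebra_simps)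
        qed
      qed
    qed
    obtain a b c e where Pe: "P = mat2 a b c e" by (rule mat2_cases)
    show thesis
    proof (cases "det P > 0")
      case True then show thesis using P u1 by (intro hyperbolic)
    next
      case False
      \<comment> \<open>Negating the second column changes the sign of the determinant and keeps the
        eigenvectors.\<close>
      then show thesis
        using P u1 by (intro hyperbolic[of "mat2 a (-b) c (-e)" u]) (simp_all add: Pe A)
    qed
  qed
qed

text \<open>In the basis given by the columns of \<open>P\<close>, both matrices are nonnegative and neither is diagonal,
  so both map the positive quadrant strictly inside itself.\<close>

definition common_cone :: "real^2^2 \<Rightarrow> real^2^2 \<Rightarrow> real^2^2 \<Rightarrow> bool" where
  "common_cone P F G \<longleftrightarrow> det P \<noteq> 0 \<and>
    (\<forall>A\<in>{F, G}. \<exists>a b c d. A ** P = P ** mat2 a b c d \<and> 0 \<le> a \<and> 0 \<le> b \<and> 0 \<le> c \<and> 0 \<le> d \<and> 0 < b + c)"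

lemma common_coneI:
  assumes "det P \<noteq> 0" "F ** P = P ** mat2 a b c d" "G ** P = P ** mat2 a' b' c' d'"
    and "0 \<le> a" "0 \<le> b" "0 \<le> c" "0 \<le> d" "0 < b + c" "0 \<le> a'" "0 \<le> b'" "0 \<le> c'" "0 \<le> d'" "0 < b' + c'"
  shows "common_cone P F G"
  unfolding common_cone_def using assms by blast

lemma common_cone_conj:
  assumes P: "det P \<noteq> 0" and FG: "F ** P = P ** N" "G ** P = P ** H"
    and Q: "common_cone Q N H"
  shows "common_cone (P ** Q) F G"
proof -
  have *: "A ** (P ** Q) = P ** (B ** Q)" if "A ** P = P ** B" for A B
    using that by (simp add: matrix_mul_assoc)
  show ?thesis using assms(4) P *[OF FG(1)] *[OF FG(2)]
    unfolding common_cone_def by (auto simp: det_mul matrix_mul_assoc) (metis matrix_mul_assoc)+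
qed

text \<open>\<open>(a - d) / (2 * c)\<close> is the midpoint of the fixed points; moving it to \<open>0\<close> makes the diagonal constant.\<close>

lemma midpoint_conj:
  fixes a b c d :: real
  assumes det: "a * d - b * c = 1" and c: "c \<noteq> 0"
  defines "e \<equiv> (a + d) / 2" and "P \<equiv> mat2 (sgn c) ((a - d) / (2 * c)) 0 1"
  shows "det P \<noteq> 0" "mat2 a b c d ** P = P ** mat2 e ((e\<^sup>2 - 1) / \<bar>c\<bar>) \<bar>c\<bar> e"
proof -
  define h where "h = (a - d) / 2"
  have ad: "a = e + h" "d = e - h" by (simp_all add: e_def h_def field_simps)
  have "b * c = e\<^sup>2 - 1 - h\<^sup>2" using det by (simp add: ad power2_eq_square algebra_simps)
  then have b: "b = (e\<^sup>2 - 1 - h\<^sup>2) / c" using c by (simp add: field_simps)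
  have P: "P = mat2 (sgn c) (h / c) 0 1" by (simp add: P_def h_def)
  show "det P \<noteq> 0" using c by (simp add: P_def sgn_0_0)
  have "sgn c * ((e\<^sup>2 - 1) / \<bar>c\<bar>) = (e\<^sup>2 - 1) / c" "sgn c * \<bar>c\<bar> = c" "c * sgn c = \<bar>c\<bar>"
    using c by (auto simp: sgn_if minus_divide_left)
  then show "mat2 a b c d ** P = P ** mat2 e ((e\<^sup>2 - 1) / \<bar>c\<bar>) \<bar>c\<bar> e"
    unfolding P using c by (simp add: b ad field_simps power2_eq_square)
qed

text \<open>The basis of \<open>midpoint_conj\<close> makes the second matrix nonnegative, since
  \<open>e \<ge> 1\<close>. It turns \<open>t\<close> into \<open>sgn c * t\<close>, which is
  positive because \<open>c\<close> and \<open>t\<close> have the same sign.\<close>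

lemma common_cone_parabolic:
  assumes det: "a * d - b * c = 1" and ct: "c * t > 0" and tr: "a + d \<ge> 2"
  shows "\<exists>P. common_cone P (mat2 1 t 0 1) (mat2 a b c d)"
proof -
  define e where "e = (a + d) / 2"
  define P where "P = mat2 (sgn c) ((a - d) / (2 * c)) 0 1"
  have c: "c \<noteq> 0" using ct by auto
  have e: "e \<ge> 1" "e\<^sup>2 \<ge> 1" using tr by (simp_all add: e_def)
  have "t = sgn c * \<bar>t\<bar>" using ct by (auto simp: sgn_if zero_less_mult_iff)
  then have "mat2 1 t 0 1 ** P = P ** mat2 1 \<bar>t\<bar> 0 1" by (simp add: P_def)
  moreover have "t \<noteq> 0" using ct by auto
  ultimately have "common_cone P (mat2 1 t 0 1) (mat2 a b c d)"
    using midpoint_conj[OF det c, folded P_def e_def] e c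
    by (intro common_coneI) (auto intro: add_nonneg_pos)
  then show ?thesis ..
qed

text \<open>In the basis of \<open>midpoint_conj\<close> the diagonal matrix acquires the upper
  right entry \<open>x * (u - 1/u)\<close>, with the sign of \<open>a - d\<close>.\<close>

lemma common_cone_parallel:
  assumes det: "a * d - b * c = 1" and u: "u > 1" and c: "c \<noteq> 0" and ad: "a > d"
    and tr: "a + d \<ge> 2"
  shows "\<exists>P. common_cone P (mat2 u 0 0 (1/u)) (mat2 a b c d)"
proof -
  define e where "e = (a + d) / 2"
  define x where "x = (a - d) / (2 * \<bar>c\<bar>)"
  define P where "P = mat2 (sgn c) ((a - d) / (2 * c)) 0 1"
  have e: "e \<ge> 1" "e\<^sup>2 \<ge> 1" using tr by (simp_all add: e_def)
  have sx: "sgn c * x = (a - d) / (2 * c)"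
    using c by (cases "0 < c") (simp_all add: x_def sgn_if field_simps)
  have x: "x > 0" using ad c by (simp add: x_def)
  have "mat2 u 0 0 (1/u) ** P = P ** mat2 u (x * (u - 1/u)) 0 (1/u)"
    unfolding P_def sx[symmetric] by (simp add: algebra_simps)
  moreover have "x * (u - 1/u) > 0" using x u less_1_mult[of u u] by (simp add: field_simps)
  ultimately have "common_cone P (mat2 u 0 0 (1/u)) (mat2 a b c d)"
    using midpoint_conj[OF det c, folded P_def e_def] e c u
    by (intro common_coneI) (auto intro: add_nonneg_pos)
  then show ?thesis ..
qed

text \<open>For positive \<open>b\<close> and \<open>c\<close> both matrices preserve the positive
  quadrant, but the diagonal one maps it onto itself. So the ray through \<open>(0, 1)\<close> is
  replaced by its image, the ray through \<open>(b, d)\<close>, which the diagonal matrix moves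
  inwards. A reflection reduces negative \<open>b\<close> and \<open>c\<close> to this case.\<close>

lemma common_cone_crossing:
  assumes det: "a * d - b * c = 1" and u: "u > 1" and bc: "b * c > 0" and tr: "a + d > 0"
  shows "\<exists>P. common_cone P (mat2 u 0 0 (1/u)) (mat2 a b c d)"
proof -
  have w: "u - 1/u > 0" using u less_1_mult[of u u] by (simp add: field_simps)
  have "a * d > 0" using det bc by simp
  then have ad: "a > 0" "d > 0" using tr by (auto simp: zero_less_mult_iff)
  have main: "\<exists>P. common_cone P (mat2 u 0 0 (1/u)) (mat2 a b c d)"
    if det: "a * d - b * c = 1" and bc: "b > 0" "c > 0" for b c
  proof -
    define P where "P = mat2 1 (b / d) 0 1"
    have "mat2 u 0 0 (1/u) ** P = P ** mat2 u (b / d * (u - 1/u)) 0 (1/u)"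
      by (simp add: P_def algebra_simps)
    moreover have "a * d = 1 + b * c" using det by simp
    then have a: "a = (1 + b * c) / d" using ad by (simp add: field_simps)
    have "mat2 a b c d ** P = P ** mat2 (1 / d) (b / d\<^sup>2) c (c * b / d + d)"
      unfolding a using ad by (simp add: P_def power2_eq_square field_simps)
    moreover have "b / d * (u - 1/u) > 0" using bc ad w by simp
    moreover have "b / d\<^sup>2 \<ge> 0" "c * b / d + d \<ge> 0" "0 < b / d\<^sup>2 + c"
      using bc ad by (simp_all add: add_pos_pos)
    moreover have "det P \<noteq> 0" by (simp add: P_def)
    ultimately have "common_cone P (mat2 u 0 0 (1/u)) (mat2 a b c d)"
      using bc ad u
      by (intro common_coneI[of P _ u "b / d * (u - 1/u)" 0 "1/u" _ "1/d" "b / d\<^sup>2" c "c * b / d + d"]) simp_all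
    then show ?thesis ..
  qed
  consider "b > 0" "c > 0" | "b < 0" "c < 0" using bc by (auto simp: zero_less_mult_iff)
  then show ?thesis
  proof cases
    case 1 then show ?thesis using main det by simp
  next
    case 2
    then obtain Q where Q: "common_cone Q (mat2 u 0 0 (1/u)) (mat2 a (-b) (-c) d)"
      using main[of "-b" "-c"] det by auto
    have "common_cone (mat2 1 0 0 (-1) ** Q) (mat2 u 0 0 (1/u)) (mat2 a b c d)"
      by (rule common_cone_conj[OF _ _ _ Q]) simp_all
    then show ?thesis by blast
  qed
qed

subsection \<open>Arcs of the extended real line\<close>

text \<open>Homogeneous coordinates on the extended real line; the zero vector gets the dummy value
  \<open>None\<close>.\<close>

definition proj :: "real \<Rightarrow> real \<Rightarrow> complex option" where
  "proj x y = (if y = 0 then None else Some (complex_of_real (x / y)))"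

lemma proj_ext_reals: "proj x y \<in> ext_reals"
  by (auto simp: proj_def ext_reals_def)

lemma proj_eqD:
  assumes "proj x y = proj x' y'" shows "x * y' = x' * y"
proof (cases "y = 0 \<or> y' = 0")
  case True then show ?thesis using assms by (auto simp: proj_def split: if_splits)
next
  case False
  then have "x / y = x' / y'" using assms by (simp add: proj_def del: of_real_divide)
  then show ?thesis using False by (simp add: field_simps)
qed

lemma proj_scale: "r \<noteq> 0 \<Longrightarrow> proj (r * x) (r * y) = proj x y"
  by (simp add: proj_def)

lemma moebius_map_proj:
  assumes "det (mat2 a b c d) \<noteq> 0" "x \<noteq> 0 \<or> y \<noteq> 0"
  shows "moebius_map (mat2 a b c d) (proj x y) = proj (a * x + b * y) (c * x + d * y)"
proof (cases "y = 0")
  case True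
  then show ?thesis using assms by (simp add: proj_def moebius_map_def)
next
  case False
  have 1: "complex_of_real c * of_real (x / y) + of_real d = of_real ((c * x + d * y) / y)"
    and 2: "complex_of_real a * of_real (x / y) + of_real b = of_real ((a * x + b * y) / y)"
    using False by (simp_all add: field_simps)
  show ?thesis using False
    unfolding proj_def moebius_map_def Let_def mat2_nth
    by (simp add: 1 2 del: of_real_divide) (simp flip: of_real_divide)
qed

text \<open>The image of \<open>[0, \<infinity>]\<close> under \<open>P\<close>.\<close>

definition arc :: "real^2^2 \<Rightarrow> complex option set" where
  "arc P = (\<lambda>s. proj (P$1$1 * s + P$1$2 * (1 - s)) (P$2$1 * s + P$2$2 * (1 - s))) ` {0..1}"

text \<open>The definition uses the segment \<open>s + t = 1\<close>, suited to compactness and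
  connectedness; rescaling gives the whole quadrant without the origin, on which linear maps
  act.\<close>

lemma arc_iff:
  "z \<in> arc (mat2 a b c d) \<longleftrightarrow>
    (\<exists>s t. 0 \<le> s \<and> 0 \<le> t \<and> (s \<noteq> 0 \<or> t \<noteq> 0) \<and> z = proj (a * s + b * t) (c * s + d * t))"
proof
  assume "z \<in> arc (mat2 a b c d)"
  then obtain s where "s \<in> {0..1}" "z = proj (a * s + b * (1 - s)) (c * s + d * (1 - s))"
    by (auto simp: arc_def)
  then show "\<exists>s t. 0 \<le> s \<and> 0 \<le> t \<and> (s \<noteq> 0 \<or> t \<noteq> 0) \<and> z = proj (a * s + b * t) (c * s + d * t)"
    by (intro exI[of _ s] exI[of _ "1 - s"]) auto
next
  assume "\<exists>s t. 0 \<le> s \<and> 0 \<le> t \<and> (s \<noteq> 0 \<or> t \<noteq> 0) \<and> z = proj (a * s + b * t) (c * s + d * t)"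
  then obtain s t where st: "0 \<le> s" "0 \<le> t" "s + t > 0" "z = proj (a * s + b * t) (c * s + d * t)"
    by (auto simp: add_pos_nonneg add_nonneg_pos order.not_eq_order_implies_strict)
  then have "z = proj (1 / (s + t) * (a * s + b * t)) (1 / (s + t) * (c * s + d * t))"
    by (subst proj_scale) auto
  moreover have t: "1 - s / (s + t) = t / (s + t)" using st by (simp add: field_simps)
  ultimately have "z = proj (a * (s / (s+t)) + b * (1 - s / (s+t))) (c * (s / (s+t)) + d * (1 - s / (s+t)))"
    unfolding t by (simp add: distrib_left mult.commute mult.left_commute)
  moreover have "s / (s + t) \<in> {0..1}" using st by simp
  ultimately show "z \<in> arc (mat2 a b c d)" unfolding arc_def mat2_nth by (rule image_eqI)
qed

text \<open>The preimage of a compact set lies in the closed set \<open>W\<close> where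
  \<open>\<bar>p\<bar> \<le> \<bar>B\<bar> * \<bar>q\<bar>\<close>; there \<open>q\<close> has no
  zero, as \<open>p\<close> and \<open>q\<close> have none in common, so \<open>p / q\<close> is
  continuous. For a closed set containing infinity, the complement is treated on the open set where
  \<open>q\<close> is nonzero.\<close>

lemma continuous_map_proj:
  fixes p q :: "real \<Rightarrow> real"
  assumes cont: "continuous_on I p" "continuous_on I q" and nz: "\<And>x. x \<in> I \<Longrightarrow> p x \<noteq> 0 \<or> q x \<noteq> 0"
  shows "continuous_map (top_of_set I) (Alexandroff_compactification euclidean) (\<lambda>x. proj (p x) (q x))"
    (is "continuous_map _ ?A ?\<gamma>")
  unfolding continuous_map_closedin
proof (intro conjI allI impI)
  define h where "h x = complex_of_real (p x / q x)" for x
  show "?\<gamma> \<in> topspace (top_of_set I) \<rightarrow> topspace ?A"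
    by (auto simp: proj_def)
  fix C assume "closedin ?A C"
  then consider (compact) K where "compact K" "C = Some ` K"
    | (co) V where "open V" "C = topspace ?A - Some ` V"
    unfolding closedin_Alexandroff_compactification by (auto simp: compactin_euclidean_iff)
  then show "closedin (top_of_set I) {x \<in> topspace (top_of_set I). ?\<gamma> x \<in> C}"
  proof cases
    case compact
    obtain B where B: "\<And>z. z \<in> K \<Longrightarrow> norm z \<le> B"
      using compact_imp_bounded[OF compact(1)] bounded_iff by blast
    define W where "W = I \<inter> (\<lambda>x. \<bar>p x\<bar> - \<bar>B\<bar> * \<bar>q x\<bar>) -` {..0}"
    have W: "closedin (top_of_set I) W" unfolding W_def
      by (intro continuous_closedin_preimage continuous_intros cont closed_atMost)
    have Wq: "q x \<noteq> 0" if "x \<in> W" for x using that nz[of x] by (auto simp: W_def)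
    have "W \<subseteq> I" by (auto simp: W_def)
    then have "continuous_on W h" unfolding h_def
      using Wq by (intro continuous_intros continuous_on_subset[OF cont(1)] continuous_on_subset[OF cont(2)]) auto
    then have "closedin (top_of_set W) (W \<inter> h -` K)"
      by (intro continuous_closedin_preimage compact_imp_closed compact(1))
    then have "closedin (top_of_set I) (W \<inter> h -` K)" using W closedin_trans by blast
    moreover have "{x \<in> topspace (top_of_set I). ?\<gamma> x \<in> C} = W \<inter> h -` K"
    proof -
      have "x \<in> W" if "x \<in> I" "q x \<noteq> 0" "h x \<in> K" for x
      proof -
        have "\<bar>p x\<bar> / \<bar>q x\<bar> \<le> \<bar>B\<bar>" using B[OF that(3)] unfolding h_def norm_of_real abs_divide by linarith
        then show ?thesis using that by (simp add: W_def field_simps)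
      qed
      then show ?thesis using Wq \<open>W \<subseteq> I\<close> unfolding compact(2) by (auto simp: proj_def h_def)
    qed
    ultimately show ?thesis by simp
  next
    case co
    define W where "W = I \<inter> q -` (- {0})"
    have W: "openin (top_of_set I) W" unfolding W_def
      by (intro continuous_openin_preimage_gen cont) auto
    have "W \<subseteq> I" by (auto simp: W_def)
    then have "continuous_on W h" unfolding h_def
      by (intro continuous_intros continuous_on_subset[OF cont(1)] continuous_on_subset[OF cont(2)])
        (auto simp: W_def)
    then have "openin (top_of_set W) (W \<inter> h -` V)"
      by (intro continuous_openin_preimage_gen co)
    then have "openin (top_of_set I) (W \<inter> h -` V)" using W openin_trans by blast
    moreover have "{x \<in> topspace (top_of_set I). ?\<gamma> x \<in> C} = I - (W \<inter> h -` V)"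
      unfolding co(2) by (auto simp: proj_def h_def W_def)
    ultimately show ?thesis by (simp add: closedin_diff)
  qed
qed

lemma linear_nonzero:
  fixes a b c d s t :: real
  assumes "a * d - b * c \<noteq> 0" "s \<noteq> 0 \<or> t \<noteq> 0"
  shows "a * s + b * t \<noteq> 0 \<or> c * s + d * t \<noteq> 0"
proof (rule ccontr)
  assume "\<not> ?thesis"
  then have "a * s + b * t = 0" "c * s + d * t = 0" by auto
  then have "(a * d - b * c) * s = 0" "(a * d - b * c) * t = 0" by algebra+
  then show False using assms by auto
qed

lemma closed_interval_arc:
  assumes "det P \<noteq> 0"
  shows "closed_interval (arc P)"
proof -
  obtain a b c d where P: "P = mat2 a b c d" by (rule mat2_cases)
  have det: "a * d - b * c \<noteq> 0" using assms by (simp add: P)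
  define \<gamma> where "\<gamma> s = proj (a * s + b * (1 - s)) (c * s + d * (1 - s))" for s
  have J: "arc P = \<gamma> ` {0..1}" by (simp add: arc_def P \<gamma>_def)
  let ?A = "Alexandroff_compactification (euclidean :: complex topology)"
  have cont: "continuous_map (top_of_set {0..1}) ?A \<gamma>" unfolding \<gamma>_def
    by (intro continuous_map_proj continuous_intros linear_nonzero[OF det]) auto
  have "connectedin ?A (\<gamma> ` {0..1})" "compactin ?A (\<gamma> ` {0..1})"
    by (rule connectedin_continuous_map_image[OF cont] image_compactin[OF _ cont],
        simp add: connectedin_subtopology compactin_subtopology)+
  moreover have "Hausdorff_space ?A"
    by (simp add: Hausdorff_space_Alexandroff_compactification locally_compact_space_euclidean)
  ultimately have "closedin ?A (arc P)" "connectedin ?A (arc P)"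
    by (auto simp: J intro: compactin_imp_closedin)
  moreover have sub: "arc P \<subseteq> ext_reals" by (auto simp: arc_def proj_ext_reals)
  ultimately have "closedin ext_reals_topology (arc P)" "connectedin ext_reals_topology (arc P)"
    unfolding ext_reals_topology_def
    by (auto simp: connectedin_subtopology closedin_subset_topspace)
  moreover have "arc P \<noteq> {p}" for p
  proof
    assume "arc P = {p}"
    moreover have "\<gamma> 0 \<in> arc P" "\<gamma> 1 \<in> arc P" by (simp_all add: J)
    ultimately have "\<gamma> 0 = \<gamma> 1" by simp
    then show False using det by (auto simp: \<gamma>_def dest!: proj_eqD)
  qed
  moreover have "arc P \<noteq> ext_reals"
  proof
    assume "arc P = ext_reals"
    \<comment> \<open>This point has coordinates \<open>(1, -1)\<close> in the basis
      \<open>P\<close>, outside the quadrant and its negative.\<close>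
    then have "proj (a - b) (c - d) \<in> arc P" using proj_ext_reals by simp
    then obtain s where s: "\<gamma> s = proj (a - b) (c - d)" by (auto simp: J)
    have "(a * s + b * (1 - s)) * (c - d) = (a - b) * (c * s + d * (1 - s))"
      using proj_eqD[OF s[unfolded \<gamma>_def]] .
    then have "a * d - b * c = 0" by algebra
    then show False using det by simp
  qed
  moreover have "arc P \<noteq> {}" by (simp add: arc_def)
  ultimately show ?thesis by (auto simp: closed_interval_def)
qed

text \<open>Nonnegative entries preserve the quadrant, and \<open>a * d = 1 + b * c\<close> makes
  \<open>a\<close> and \<open>d\<close> positive. Hence \<open>c > 0\<close> keeps the image off the
  ray through \<open>(1, 0)\<close>, and \<open>b > 0\<close> off the one through
  \<open>(0, 1)\<close>, so an endpoint of the arc is missed.\<close>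

lemma strictly_inside_arc:
  assumes A: "det A = 1" and P: "det P \<noteq> 0" and AP: "A ** P = P ** mat2 a b c d"
    and nn: "0 \<le> a" "0 \<le> b" "0 \<le> c" "0 \<le> d" "0 < b + c"
  shows "strictly_inside_itself (moebius_map A) (arc P)"
proof -
  obtain p q r v where Pe: "P = mat2 p q r v" by (rule mat2_cases)
  obtain i j k l where Ae: "A = mat2 i j k l" by (rule mat2_cases)
  have dP: "p * v - q * r \<noteq> 0" using P by (simp add: Pe)
  have "det A * det P = det P * det (mat2 a b c d)" using AP by (metis det_mul)
  then have dN: "a * d - b * c = 1" using A P by simp
  moreover have "b * c \<ge> 0" using nn by simp
  ultimately have "a * d > 0" by linarith
  then have ad: "a > 0" "d > 0" using nn by (simp_all add: zero_less_mult_iff)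
  have eqs: "i * p + j * r = p * a + q * c" "i * q + j * v = p * b + q * d"
    "k * p + l * r = r * a + v * c" "k * q + l * v = r * b + v * d"
    using AP by (simp_all add: Ae Pe)
  have im: "moebius_map A (proj (p * s + q * t) (r * s + v * t)) =
      proj (p * (a * s + b * t) + q * (c * s + d * t)) (r * (a * s + b * t) + v * (c * s + d * t))"
    if "s \<noteq> 0 \<or> t \<noteq> 0" for s t
  proof -
    have "moebius_map A (proj (p * s + q * t) (r * s + v * t)) =
      proj (i * (p * s + q * t) + j * (r * s + v * t)) (k * (p * s + q * t) + l * (r * s + v * t))"
      unfolding Ae using A linear_nonzero[OF dP that] by (intro moebius_map_proj) (simp_all add: Ae)
    moreover have "i * (p * s + q * t) + j * (r * s + v * t) = p * (a * s + b * t) + q * (c * s + d * t)"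
      using eqs by algebra
    moreover have "k * (p * s + q * t) + l * (r * s + v * t) = r * (a * s + b * t) + v * (c * s + d * t)"
      using eqs by algebra
    ultimately show ?thesis by simp
  qed
  have dN': "a * d - b * c \<noteq> 0" using dN by simp
  have "moebius_map A ` arc P \<subseteq> arc P"
  proof clarify
    fix z assume "z \<in> arc P"
    then obtain s t where st: "0 \<le> s" "0 \<le> t" "s \<noteq> 0 \<or> t \<noteq> 0" "z = proj (p * s + q * t) (r * s + v * t)"
      unfolding Pe arc_iff by blast
    show "moebius_map A z \<in> arc P"
      unfolding st(4) im[OF st(3)] unfolding Pe arc_iff
      using st(1,2) nn linear_nonzero[OF dN' st(3)]
      by (intro exI[of _ "a * s + b * t"] exI[of _ "c * s + d * t"]) auto
  qed
  moreover have "moebius_map A ` arc P \<noteq> arc P"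
  proof
    assume eq: "moebius_map A ` arc P = arc P"
    have pre: "\<exists>s t. 0 \<le> s \<and> 0 \<le> t \<and> (s \<noteq> 0 \<or> t \<noteq> 0) \<and> (a * s + b * t) * y = x * (c * s + d * t)"
      if xy: "0 \<le> x" "0 \<le> y" "x \<noteq> 0 \<or> y \<noteq> 0" for x y
    proof -
      have "proj (p * x + q * y) (r * x + v * y) \<in> arc P" unfolding Pe arc_iff using xy by blast
      then obtain z where z: "z \<in> arc P" "proj (p * x + q * y) (r * x + v * y) = moebius_map A z"
        using eq by blast
      then obtain s t where st: "0 \<le> s" "0 \<le> t" "s \<noteq> 0 \<or> t \<noteq> 0" "z = proj (p * s + q * t) (r * s + v * t)"
        unfolding Pe arc_iff by blast
      have "(p * x + q * y) * (r * (a * s + b * t) + v * (c * s + d * t)) =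
          (p * (a * s + b * t) + q * (c * s + d * t)) * (r * x + v * y)"
        using z(2) unfolding st(4) im[OF st(3)] by (rule proj_eqD)
      then have "(p * v - q * r) * ((a * s + b * t) * y - x * (c * s + d * t)) = 0" by algebra
      then show ?thesis using dP st by auto
    qed
    show False
    proof (cases "c > 0")
      case True
      obtain s t where "0 \<le> s" "0 \<le> t" "s \<noteq> 0 \<or> t \<noteq> 0" "c * s + d * t = 0" using pre[of 1 0] by auto
      then show False using True ad by (simp add: add_nonneg_eq_0_iff)
    next
      case False
      then have "b > 0" using nn by simp
      obtain s t where "0 \<le> s" "0 \<le> t" "s \<noteq> 0 \<or> t \<noteq> 0" "a * s + b * t = 0" using pre[of 0 1] by auto
      then show False using \<open>b > 0\<close> ad by (simp add: add_nonneg_eq_0_iff)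
    qed
  qed
  ultimately show ?thesis by (simp add: strictly_inside_itself_def)
qed

section \<open>Lifting the semigroup to matrices\<close>

lemma moebius_map_eq_id:
  assumes "det A = 1" "moebius_map A = id"
  shows "A = mat 1 \<or> A = - mat 1"
proof -
  obtain a b c d where A: "A = mat2 a b c d" by (rule mat2_cases)
  have c: "c = 0" using fun_cong[OF assms(2), of None] by (auto simp: moebius_map_def A split: if_splits)
  then have ad: "a * d = 1" using assms(1) by (simp add: A)
  have b: "b = 0" using fun_cong[OF assms(2), of "Some 0"] ad
    by (auto simp: moebius_map_def A c split: if_splits)
  have "complex_of_real a = of_real d"
    using fun_cong[OF assms(2), of "Some 1"] ad by (auto simp: moebius_map_def A b c split: if_splits)
  then have "a = d" by simp
  then have "a = 1 \<or> a = -1" using ad by (simp add: square_eq_1_iff)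
  then show ?thesis using \<open>a = d\<close> by (auto simp: A b c mat2_one)
qed

lemma moebius_map_uminus: "moebius_map (- A) = moebius_map A"
  using moebius_map_scale[of "-1" A] by simp

text \<open>In the quotient topology, a neighbourhood isolating \<open>id\<close> in
  \<open>S\<close> pulls back to an open subset of \<open>SL2\<close> around \<open>mat 1\<close>,
  which every sequence tending to \<open>mat 1\<close> enters. The other lift \<open>- mat 1\<close>
  of \<open>id\<close> is excluded by the sign of a diagonal entry.\<close>

lemma semidiscrete_matrices_lifts:
  assumes sub: "S \<subseteq> moebius_group" and comp: "\<And>h k. h \<in> S \<Longrightarrow> k \<in> S \<Longrightarrow> h \<circ> k \<in> S"
    and sd: "semidiscrete S"
  shows "semidiscrete_matrices {A. det A = 1 \<and> moebius_map A \<in> S}"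
proof
  fix A B assume "A \<in> {A. det A = 1 \<and> moebius_map A \<in> S}" "B \<in> {A. det A = 1 \<and> moebius_map A \<in> S}"
  then show "A ** B \<in> {A. det A = 1 \<and> moebius_map A \<in> S}"
    by (simp add: det_mul moebius_map_mult comp)
next
  fix A assume "A \<in> {A. det A = 1 \<and> moebius_map A \<in> S}"
  then show "- A \<in> {A. det A = 1 \<and> moebius_map A \<in> S}"
    by (simp add: det_uminus2 moebius_map_uminus)
next
  fix X :: "nat \<Rightarrow> real^2^2"
  assume X: "\<And>n. X n \<in> {A. det A = 1 \<and> moebius_map A \<in> S}" and lim: "X \<longlonglongrightarrow> mat 1"
  have "mat 1 \<in> SL2" by (simp add: SL2_def)
  then have "id \<in> moebius_group" unfolding moebius_group_eq_SL2 by (metis imageI moebius_map_mat_1)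
  then obtain T where T: "openin moebius_topology T" "id \<in> T" "\<And>h. h \<in> S \<Longrightarrow> h \<in> T \<Longrightarrow> h = id"
    using sd by (auto simp: semidiscrete_def in_derived_set_of)
  have "openin (top_of_set SL2) {A \<in> SL2. moebius_map A \<in> T}"
    using T(1) by (simp add: openin_moebius_topology)
  then obtain V where V: "open V" "{A \<in> SL2. moebius_map A \<in> T} = SL2 \<inter> V"
    by (auto simp: openin_open)
  have "mat 1 \<in> {A \<in> SL2. moebius_map A \<in> T}"
    using T(2) \<open>mat 1 \<in> SL2\<close> by (simp add: moebius_map_mat_1)
  then have "mat 1 \<in> V" unfolding V(2) by simp
  then have "eventually (\<lambda>n. X n \<in> V) sequentially"
    using lim V(1) by (simp add: topological_tendstoD)
  moreover have "eventually (\<lambda>n. X n $ 1 $ 1 > 0) sequentially"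
  proof (rule order_tendstoD(1))
    show "(\<lambda>n. X n $ 1 $ 1) \<longlonglongrightarrow> mat 1 $ 1 $ (1::2)" by (intro tendsto_vec_nth lim)
  qed (simp add: mat_def)
  ultimately have "eventually (\<lambda>n. X n \<in> V \<and> X n $ 1 $ 1 > 0) sequentially" by (rule eventually_conj)
  then obtain n where n: "X n \<in> V" "X n $ 1 $ 1 > 0" by (auto dest: eventually_happens)
  have "X n \<in> SL2" using X by (simp add: SL2_def)
  then have "X n \<in> {A \<in> SL2. moebius_map A \<in> T}" unfolding V(2) using n by simp
  then have "moebius_map (X n) \<in> T" by simp
  then have "moebius_map (X n) = id" using T(3) X by simp
  then have "X n = mat 1 \<or> X n = - mat 1" using moebius_map_eq_id X by simp
  then show "\<exists>n. X n = mat 1" using n(2) by (auto simp: mat_def)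
qed simp

subsection \<open>Elementary pairs\<close>

text \<open>The points may coincide, so that a common fixed point and a swapped pair are covered
  alike.\<close>

definition preserves_pair :: "('a \<Rightarrow> 'a) \<Rightarrow> ('a \<Rightarrow> 'a) \<Rightarrow> 'a \<Rightarrow> 'a \<Rightarrow> bool" where
  "preserves_pair f g p q \<longleftrightarrow> {f p, f q, g p, g q} \<subseteq> {p, q}"

lemma elementary_preserves_pair:
  assumes "preserves_pair f g p q" "p \<in> closed_half_plane"
  shows "elementary (semigroup_generated {f, g})"
proof -
  have "h p \<in> {p, q} \<and> h q \<in> {p, q}" if "h \<in> semigroup_generated {f, g}" for h
    using that
  proof (induction rule: semigroup_generated.induct)
    case (gen h) then show ?case using assms(1) unfolding preserves_pair_def by blast
  next
    case (comp h k)
    have "h (k x) \<in> {p, q}" if "k x \<in> {p, q}" for x using that comp.IH(1) by (elim insertE emptyE) simp_all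
    then show ?case using comp.IH(2) by simp
  qed
  then have "(\<lambda>h. h p) ` semigroup_generated {f, g} \<subseteq> {p, q}" by blast
  then have "finite ((\<lambda>h. h p) ` semigroup_generated {f, g})" by (rule finite_subset) simp
  then show ?thesis using assms(2) by (auto simp: elementary_def)
qed

definition elementary_pair :: "real^2^2 \<Rightarrow> real^2^2 \<Rightarrow> bool" where
  "elementary_pair F G \<longleftrightarrow> (\<exists>p\<in>closed_half_plane. \<exists>q. preserves_pair (moebius_map F) (moebius_map G) p q)"

lemma moebius_map_closed_half_plane:
  assumes "det P > 0" "p \<in> closed_half_plane"
  shows "moebius_map P p \<in> closed_half_plane"
proof -
  obtain a b c d where P: "P = mat2 a b c d" by (rule mat2_cases)
  have det: "a * d - b * c > 0" using assms(1) by (simp add: P)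
  from assms(2) consider z where "p = Some z" "Im z > 0" | "p = proj 1 0" | x where "p = proj x 1"
    by (auto simp: closed_half_plane_def ext_reals_def proj_def Reals_def)
  then show ?thesis
  proof cases
    case 1
    define w where "w = of_real c * z + of_real d"
    have w: "w \<noteq> 0"
    proof
      assume "w = 0"
      then have "c * Im z = 0" "c * Re z + d = 0" by (auto simp: w_def complex_eq_iff)
      then have "c = 0" "d = 0" using 1 by auto
      then show False using det by simp
    qed
    have "Im ((of_real a * z + of_real b) / w) = (a * d - b * c) * Im z / ((Re w)\<^sup>2 + (Im w)\<^sup>2)"
      unfolding Im_divide by (simp add: w_def algebra_simps)
    also have "\<dots> > 0"
      using w 1 det by (intro divide_pos_pos mult_pos_pos) (auto simp: sum_power2_gt_zero_iff complex_eq_iff)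
    finally show ?thesis
      using w 1 by (simp add: moebius_map_def P w_def closed_half_plane_def)
  next
    case 2
    then show ?thesis unfolding P 2
      using det by (subst moebius_map_proj) (simp_all add: proj_ext_reals closed_half_plane_def)
  next
    case 3
    then show ?thesis unfolding P 3
      using det by (subst moebius_map_proj) (simp_all add: proj_ext_reals closed_half_plane_def)
  qed
qed

lemma elementary_pair_conj:
  assumes P: "det P > 0" and FG: "F ** P = P ** N" "G ** P = P ** H" "det F = 1" "det G = 1"
    and NH: "elementary_pair N H"
  shows "elementary_pair F G"
proof -
  have eq: "moebius_map A (moebius_map P p) = moebius_map P (moebius_map B p)"
    if AP: "A ** P = P ** B" and A: "det A = 1" for A B p
  proof -
    have "det A * det P = det P * det B" using AP by (metis det_mul)
    then have "det B \<noteq> 0" using A P by auto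
    then show ?thesis
      using fun_cong[OF moebius_map_mult[of A P], of p] fun_cong[OF moebius_map_mult[of P B], of p] A P AP
      by simp
  qed
  obtain p q where pq: "p \<in> closed_half_plane" "preserves_pair (moebius_map N) (moebius_map H) p q"
    using NH by (auto simp: elementary_pair_def)
  then have "preserves_pair (moebius_map F) (moebius_map G) (moebius_map P p) (moebius_map P q)"
    by (auto simp: preserves_pair_def eq[OF FG(1,3)] eq[OF FG(2,4)])
  then show ?thesis
    using moebius_map_closed_half_plane[OF P pq(1)] by (auto simp: elementary_pair_def)
qed

lemma elementary_pair_None:
  assumes "a \<noteq> 0" "c \<noteq> 0"
  shows "elementary_pair (mat2 a b 0 d) (mat2 c e 0 f)"
  unfolding elementary_pair_def preserves_pair_def
  by (intro bexI[of _ None] exI[of _ None]) (auto simp: moebius_map_def closed_half_plane_def ext_reals_def)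

lemma elementary_pair_zero:
  assumes "d \<noteq> 0" "f \<noteq> 0"
  shows "elementary_pair (mat2 a 0 b d) (mat2 c 0 e f)"
  unfolding elementary_pair_def preserves_pair_def
  by (intro bexI[of _ "Some 0"] exI[of _ "Some 0"])
    (auto simp: moebius_map_def closed_half_plane_def ext_reals_def assms)

lemma elementary_pair_swap:
  assumes "b \<noteq> 0" "c \<noteq> 0" "u \<noteq> 0" "v \<noteq> 0"
  shows "elementary_pair (mat2 u 0 0 v) (mat2 0 b c 0)"
  unfolding elementary_pair_def preserves_pair_def
  by (intro bexI[of _ None] exI[of _ "Some 0"])
    (auto simp: moebius_map_def closed_half_plane_def ext_reals_def assms)

lemma moebius_map_rotation:
  assumes "k\<^sup>2 + s\<^sup>2 = 1"
  shows "moebius_map (mat2 k (-s) s k) (Some \<i>) = Some \<i>"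
proof -
  have "complex_of_real s * \<i> + of_real k \<noteq> 0" using assms by (auto simp: complex_eq_iff)
  then have "(of_real k * \<i> + of_real (-s)) / (of_real s * \<i> + of_real k) = \<i>"
    by (simp add: field_simps)
  then show ?thesis
    using \<open>complex_of_real s * \<i> + of_real k \<noteq> 0\<close> by (simp add: moebius_map_def)
qed

lemma elementary_pair_rotation:
  assumes "k\<^sup>2 + s\<^sup>2 = 1" "l\<^sup>2 + t\<^sup>2 = 1"
  shows "elementary_pair (mat2 k (-s) s k) (mat2 l (-t) t l)"
  unfolding elementary_pair_def preserves_pair_def
  by (intro bexI[of _ "Some \<i>"] exI[of _ "Some \<i>"])
    (auto simp: closed_half_plane_def moebius_map_rotation assms)

section \<open>Conjugation to normal form and its effect on traces\<close>

lemma two_sided_inverse_exists: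
  fixes P :: "real^2^2"
  assumes "det P \<noteq> 0"
  shows "\<exists>Q. P ** Q = mat 1 \<and> Q ** P = mat 1"
  using assms invertible_det_nz[of P] unfolding invertible_def by blast

lemma elementary_pair_one:
  assumes "det G = 1" "0 \<le> trace G"
  shows "elementary_pair (mat 1) G"
proof (cases "G = mat 1")
  case True
  then show ?thesis using elementary_pair_None[of 1 1 0 1 0 1] by (simp add: mat2_one)
next
  case False
  from assms False show ?thesis
  proof (cases rule: SL2_normal_form)
    case (hyperbolic P u)
    have "elementary_pair (mat 1) (mat2 u 0 0 (1/u))"
      using hyperbolic(2) elementary_pair_None[of 1 u 0 1 0 "1/u"] by (simp add: mat2_one)
    then show ?thesis
      by (intro elementary_pair_conj[OF hyperbolic(1) _ hyperbolic(3) _ assms(1), where N = "mat 1"]) simp_all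
  next
    case (parabolic P t)
    have "elementary_pair (mat 1) (mat2 1 t 0 1)"
      using elementary_pair_None[of 1 1 0 1 t 1] by (simp add: mat2_one)
    then show ?thesis
      by (intro elementary_pair_conj[OF parabolic(1) _ parabolic(3) _ assms(1), where N = "mat 1"]) simp_all
  next
    case (elliptic P k s)
    have "elementary_pair (mat 1) (mat2 k (-s) s k)"
      using elliptic(3) elementary_pair_rotation[of 1 0 k s] by (simp add: mat2_one)
    then show ?thesis
      by (intro elementary_pair_conj[OF elliptic(1) _ elliptic(4) _ assms(1), where N = "mat 1"]) simp_all
  qed
qed

lemma trace_conj:
  fixes A B P :: "real^2^2"
  assumes "P ** Q = mat 1" "A ** P = P ** B"
  shows "trace A = trace B"
proof -
  have "A = A ** P ** Q" using assms(1) by (simp flip: matrix_mul_assoc)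
  then have "trace A = trace (Q ** (P ** B))" using assms(2) trace_mul_sym by metis
  also have "Q ** P = mat 1" using assms(1) by (simp add: matrix_left_right_inverse)
  then have "trace (Q ** (P ** B)) = trace B" by (simp add: matrix_mul_assoc)
  finally show ?thesis .
qed

lemma det_conj:
  fixes A B P :: "real^2^2"
  assumes "det P \<noteq> 0" "A ** P = P ** B"
  shows "det A = det B"
  using assms by (metis det_mul mult.commute mult_right_cancel)

lemma conj_normal_form:
  fixes F G N P :: "real^2^2"
  assumes P: "det P > 0" and FP: "F ** P = P ** N" and G: "det G = 1"
  obtains H where "G ** P = P ** H" "det H = 1" "trace H = trace G"
    "trace F = trace N" "trace (N ** H) = trace (F ** G)"
proof -
  have nz: "det P \<noteq> 0" using P by simp
  obtain Q where Q: "P ** Q = mat 1" "Q ** P = mat 1" using two_sided_inverse_exists[OF nz] by blast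
  define H where "H = Q ** G ** P"
  have H: "G ** P = P ** H" using Q by (simp add: H_def matrix_mul_assoc)
  have "F ** G ** P = F ** (P ** H)" unfolding H[symmetric] by (simp add: matrix_mul_assoc)
  also have "\<dots> = P ** (N ** H)" by (simp add: matrix_mul_assoc FP)
  finally have FG: "F ** G ** P = P ** (N ** H)" .
  show thesis
    using that[OF H] trace_conj[OF Q(1) H] trace_conj[OF Q(1) FP] trace_conj[OF Q(1) FG] det_conj[OF nz H] G
    by simp
qed

text \<open>The diagonal matrix fixes 0 and infinity; for \<open>c \<noteq> 0\<close> the fixed
  points of the other have product \<open>- b / c\<close>. So for hyperbolic matrices a negative
  value means crossing axes.\<close>

lemma fricke_diag:
  fixes u :: real
  assumes "u \<noteq> 0" "a * d - b * c = 1"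
  shows "fricke (trace (mat2 u 0 0 (1/u))) (trace (mat2 a b c d)) (trace (mat2 u 0 0 (1/u) ** mat2 a b c d)) - 2
    = - (b * c) * (u - 1/u)\<^sup>2"
proof -
  define v where "v = 1 / u"
  have v: "u * v = 1" using assms(1) by (simp add: v_def)
  have "(u + v)\<^sup>2 + (a + d)\<^sup>2 + (u * a + v * d)\<^sup>2 - (u + v) * (a + d) * (u * a + v * d) - 2 - 2
      = - (b * c) * (u - v)\<^sup>2"
    using v assms(2) by algebra
  then show ?thesis by (simp add: fricke_def v_def)
qed

text \<open>In normal form, \<open>2 * z - x * y\<close> is \<open>(a - d) * (u - 1/u)\<close> for
  hyperbolic and \<open>2 * c * t\<close> for parabolic \<open>F\<close>, while
  \<open>fricke x y z - 2\<close> is \<open>- (b * c) * (u - 1/u)\<^sup>2\<close> or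
  \<open>(c * t)\<^sup>2\<close>. Their signs select one of the three cone lemmas; the value 2 would
  mean a shared fixed point.\<close>

lemma real_pair_cone:
  assumes FG: "det F = 1" "det G = 1" "2 \<le> trace F" "2 \<le> trace G" "F \<noteq> mat 1"
    and ne: "\<not> elementary_pair F G"
  defines "x \<equiv> trace F" and "y \<equiv> trace G" and "z \<equiv> trace (F ** G)"
  shows "fricke x y z \<noteq> 2" and "fricke x y z < 2 \<or> x * y < 2 * z \<Longrightarrow> \<exists>P. common_cone P F G"
proof -
  have "fricke x y z \<noteq> 2 \<and> (fricke x y z < 2 \<or> x * y < 2 * z \<longrightarrow> (\<exists>P. common_cone P F G))"
  proof -
    have "0 \<le> trace F" using FG by simp
    with FG(1) show ?thesis using FG(5)
    proof (cases rule: SL2_normal_form)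
      case (hyperbolic P u)
      obtain H where H: "G ** P = P ** H" "det H = 1" "trace H = y" "x = trace (mat2 u 0 0 (1/u))"
          "trace (mat2 u 0 0 (1/u) ** H) = z"
        using conj_normal_form[OF hyperbolic(1,3) FG(2)] unfolding x_def y_def z_def by metis
      obtain a b c d where He: "H = mat2 a b c d" by (rule mat2_cases)
      have xyz: "x = u + 1/u" "y = a + d" "z = u * a + d / u" and det: "a * d - b * c = 1"
        using H by (simp_all add: He)
      have u0: "u > 0" using hyperbolic by simp
      have w: "u - 1/u > 0" using hyperbolic(2) less_1_mult[of u u] by (simp add: field_simps)
      have \<kappa>: "fricke x y z - 2 = - (b * c) * (u - 1/u)\<^sup>2"
        using fricke_diag[OF _ det, of u] H(3-5) u0 unfolding He by simp
      have ne': "\<not> elementary_pair (mat2 u 0 0 (1/u)) H"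
        using elementary_pair_conj[OF hyperbolic(1,3) H(1) FG(1,2)] ne by blast
      have "b \<noteq> 0"
      proof
        assume b: "b = 0"
        then have "d \<noteq> 0" using det by auto
        then show False using ne' u0 elementary_pair_zero[of "1/u" d u 0 a c] by (simp add: He b)
      qed
      moreover have "c \<noteq> 0"
      proof
        assume c: "c = 0"
        then have "a \<noteq> 0" using det by auto
        then show False using ne' u0 elementary_pair_None[of u a 0 "1/u" b d] by (simp add: He c)
      qed
      ultimately have bc: "b * c \<noteq> 0" by simp
      have "\<exists>P. common_cone P (mat2 u 0 0 (1/u)) H" if "fricke x y z < 2 \<or> x * y < 2 * z"
      proof (cases "fricke x y z < 2")
        case True
        then have "0 < b * c * (u - 1/u)\<^sup>2" using \<kappa> by simp
        then have "b * c > 0" by (rule zero_less_mult_pos2) (rule zero_less_power[OF w])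
        then show ?thesis
          unfolding He using common_cone_crossing[OF det hyperbolic(2)] FG(4) xyz y_def by simp
      next
        case False
        then have "(u + 1/u) * (a + d) < 2 * (u * a + d / u)" using that by (simp add: xyz)
        moreover have "(a - d) * (u - 1/u) = 2 * (u * a + d / u) - (u + 1/u) * (a + d)"
          using u0 by (simp add: field_simps)
        ultimately have "(a - d) * (u - 1/u) > 0" by linarith
        then have "a > d" using w by (simp add: zero_less_mult_iff)
        then show ?thesis
          unfolding He using common_cone_parallel[OF det hyperbolic(2) \<open>c \<noteq> 0\<close>] FG(4) xyz y_def by simp
      qed
      moreover have "fricke x y z \<noteq> 2" using \<kappa> bc w by auto
      ultimately show ?thesis
        using common_cone_conj[OF _ hyperbolic(3) H(1)] hyperbolic(1) by auto
    next
      case (parabolic P t)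
      obtain H where H: "G ** P = P ** H" "det H = 1" "trace H = y" "x = trace (mat2 1 t 0 1)"
          "trace (mat2 1 t 0 1 ** H) = z"
        using conj_normal_form[OF parabolic(1,3) FG(2)] unfolding x_def y_def z_def by metis
      obtain a b c d where He: "H = mat2 a b c d" by (rule mat2_cases)
      have xyz: "x = 2" "y = a + d" "z = a + t * c + d" and det: "a * d - b * c = 1"
        using H by (simp_all add: He)
      have \<kappa>: "fricke x y z - 2 = (c * t)\<^sup>2"
        by (simp add: fricke_def xyz power2_eq_square algebra_simps)
      have ne': "\<not> elementary_pair (mat2 1 t 0 1) H"
        using elementary_pair_conj[OF parabolic(1,3) H(1) FG(1,2)] ne by blast
      have "c \<noteq> 0"
      proof
        assume c: "c = 0"
        then have "a \<noteq> 0" using det by auto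
        then show False using ne' elementary_pair_None[of 1 a t 1 b d] by (simp add: He c)
      qed
      then have pos: "(c * t)\<^sup>2 > 0" using parabolic(2) by simp
      have "\<exists>P. common_cone P (mat2 1 t 0 1) H" if "fricke x y z < 2 \<or> x * y < 2 * z"
      proof -
        have "c * t > 0" using that \<kappa> pos by (auto simp: xyz algebra_simps)
        then show ?thesis unfolding He using common_cone_parabolic[OF det] FG(4) xyz y_def by simp
      qed
      moreover have "\<not> fricke x y z < 2" "fricke x y z \<noteq> 2" using \<kappa> pos by linarith+
      ultimately show ?thesis
        using common_cone_conj[OF _ parabolic(3) H(1)] parabolic(1) by auto
    next
      case (elliptic P k s)
      obtain H where "trace F = trace (mat2 k (-s) s k)"
        by (rule conj_normal_form[OF elliptic(1,4) FG(2)]) blast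
      then have "k \<ge> 1" using FG(3) by simp
      then have "k\<^sup>2 \<ge> 1" by simp
      moreover have "s\<^sup>2 > 0" using elliptic(2) by simp
      ultimately show ?thesis using elliptic(3) by linarith
    qed
  qed
  then show "fricke x y z \<noteq> 2" and "fricke x y z < 2 \<or> x * y < 2 * z \<Longrightarrow> \<exists>P. common_cone P F G"
    by blast+
qed

section \<open>Joergensen's inequality for units and the case distinction\<close>

context semidiscrete_matrices
begin

lemma semidiscrete_matrices_conj:
  assumes PQ: "P ** Q = mat 1" "Q ** P = mat 1"
  shows "semidiscrete_matrices {B. P ** B ** Q \<in> M}"
proof
  have dPQ: "det P * det Q = 1" using PQ(1) by (metis det_mul det_I)
  fix A assume A: "A \<in> {B. P ** B ** Q \<in> M}"
  then have "det (P ** A ** Q) = 1" using det_M by simp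
  then show "det A = 1" using dPQ by (simp add: det_mul mult.commute mult.left_commute)
  show "- A \<in> {B. P ** B ** Q \<in> M}" using A uminus_M by (simp add: mult_uminus2)
  fix B assume B: "B \<in> {B. P ** B ** Q \<in> M}"
  have "(P ** A ** Q) ** (P ** B ** Q) = P ** A ** (Q ** P) ** B ** Q" by (simp add: matrix_mul_assoc)
  then show "A ** B \<in> {B. P ** B ** Q \<in> M}"
    using A B mult_M PQ by (metis (no_types, lifting) matrix_mul_assoc matrix_mul_rid mem_Collect_eq)
next
  fix X :: "nat \<Rightarrow> real^2^2"
  assume X: "\<And>n. X n \<in> {B. P ** B ** Q \<in> M}" and lim: "X \<longlonglongrightarrow> mat 1"
  have "(\<lambda>n. P ** X n ** Q) \<longlonglongrightarrow> P ** mat 1 ** Q" by (intro tendsto_matrix_mult tendsto_const lim)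
  then obtain n where n: "P ** X n ** Q = mat 1"
    using one_isolated[of "\<lambda>n. P ** X n ** Q"] X PQ by auto
  have "X n = (Q ** P) ** X n ** (Q ** P)" by (simp add: PQ)
  also have "\<dots> = Q ** (P ** X n ** Q) ** P" by (simp add: matrix_mul_assoc)
  finally show "\<exists>n. X n = mat 1" using n PQ by auto
qed

text \<open>With \<open>F\<close> in normal form, the left side of the assumption becomes
  \<open>(u - 1/u)\<^sup>2 * (1 + \<bar>b * c\<bar>)\<close>, \<open>(c * t)\<^sup>2\<close> or
  \<open>4 * s\<^sup>2 * (1 + n)\<close>, the quantities of the three descents. These leave only
  pairs with a common fixed point or a preserved pair of points.\<close>

lemma joergensen:
  assumes F: "F \<in> U" and G: "G \<in> U" and tr: "0 \<le> trace F" "0 \<le> trace G"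
    and small: "\<bar>(trace F)\<^sup>2 - 4\<bar> + \<bar>fricke (trace F) (trace G) (trace (F ** G)) - 2\<bar> < 1"
  shows "elementary_pair F G"
proof (cases "F = mat 1")
  case True
  then show ?thesis using elementary_pair_one U_det[OF G] tr by simp
next
  case False
  have dF: "det F = 1" and dG: "det G = 1" using F G by (simp_all add: U_det)
  have conj: "\<exists>M'. semidiscrete_matrices M' \<and> N \<in> semidiscrete_matrices.U M' \<and> H \<in> semidiscrete_matrices.U M'"
    if P: "det P > 0" and FN: "F ** P = P ** N" and GH: "G ** P = P ** H" for P N H
  proof -
    obtain Q where Q: "P ** Q = mat 1" "Q ** P = mat 1" using two_sided_inverse_exists[of P] P by auto
    define M' where "M' = {B. P ** B ** Q \<in> M}"
    interpret M': semidiscrete_matrices M'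
      unfolding M'_def by (rule semidiscrete_matrices_conj[OF Q])
    have "B \<in> M'.U" if A: "A \<in> U" and AP: "A ** P = P ** B" for A B
    proof -
      have "P ** B ** Q = A" using AP Q by (metis matrix_mul_assoc matrix_mul_rid)
      then have B: "B \<in> M'" using A by (simp add: M'_def U_M)
      have "adj A ** P = adj A ** (P ** B) ** adj B"
        using mult_adj(1)[OF M'.det_M[OF B]] by (metis matrix_mul_assoc matrix_mul_rid)
      also have "\<dots> = P ** adj B" unfolding AP[symmetric] by (simp add: mult_adj_cancel(2) U_det[OF A])
      finally have "P ** adj B ** Q = adj A" using Q by (metis matrix_mul_assoc matrix_mul_rid)
      then have "adj B \<in> M'" using U_adj[OF A] by (simp add: M'_def U_M)
      with B show ?thesis by (simp add: M'.U_def)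
    qed
    then show ?thesis using F G FN GH M'.semidiscrete_matrices_axioms by blast
  qed
  have red: "elementary_pair F G" if "det P > 0" "F ** P = P ** N" "G ** P = P ** H" "elementary_pair N H" for P N H
    using elementary_pair_conj that dF dG by blast
  from dF tr(1) False show ?thesis
  proof (cases rule: SL2_normal_form)
    case (hyperbolic P u)
    obtain H where H: "G ** P = P ** H" "det H = 1" "trace H = trace G" "trace F = trace (mat2 u 0 0 (1/u))"
        "trace (mat2 u 0 0 (1/u) ** H) = trace (F ** G)"
      by (rule conj_normal_form[OF hyperbolic(1,3) dG]) blast
    obtain a b c d where He: "H = mat2 a b c d" by (rule mat2_cases)
    have det: "a * d - b * c = 1" using H(2) by (simp add: He)
    have u0: "u > 0" using hyperbolic by simp
    obtain M' where M': "semidiscrete_matrices M'" "mat2 u 0 0 (1/u) \<in> semidiscrete_matrices.U M'"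
        "mat2 a b c d \<in> semidiscrete_matrices.U M'"
      using conj[OF hyperbolic(1,3) H(1)] by (auto simp: He)
    have "fricke (trace F) (trace G) (trace (F ** G)) - 2 = - (b * c) * (u - 1/u)\<^sup>2"
      using fricke_diag[OF _ det, of u] H(3-5) u0 unfolding He by simp
    moreover have "(trace F)\<^sup>2 - 4 = (u - 1/u)\<^sup>2"
      unfolding H(4) using u0 by (simp add: power2_eq_square field_simps)
    ultimately have "(u - 1/u)\<^sup>2 * (1 + \<bar>b * c\<bar>) < 1"
      using small by (simp add: abs_mult algebra_simps)
    then have "(b = 0 \<and> c = 0) \<or> (a = 0 \<and> d = 0)"
      by (rule semidiscrete_matrices.joergensen_hyperbolic[OF M'(1) hyperbolic(2) M'(2,3)])
    then have "elementary_pair (mat2 u 0 0 (1/u)) H"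
    proof
      assume bc: "b = 0 \<and> c = 0"
      then have "a \<noteq> 0" using det by auto
      then show ?thesis using bc u0 elementary_pair_None[of u a 0 "1/u" 0 d] by (simp add: He)
    next
      assume ad: "a = 0 \<and> d = 0"
      then have "b \<noteq> 0" "c \<noteq> 0" using det by auto
      then show ?thesis using ad u0 elementary_pair_swap[of b c u "1/u"] by (simp add: He)
    qed
    then show ?thesis by (rule red[OF hyperbolic(1,3) H(1)])
  next
    case (parabolic P t)
    obtain H where H: "G ** P = P ** H" "det H = 1" "trace H = trace G" "trace F = trace (mat2 1 t 0 1)"
        "trace (mat2 1 t 0 1 ** H) = trace (F ** G)"
      by (rule conj_normal_form[OF parabolic(1,3) dG]) blast
    obtain a b c d where He: "H = mat2 a b c d" by (rule mat2_cases)
    have det: "a * d - b * c = 1" using H(2) by (simp add: He)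
    obtain M' where M': "semidiscrete_matrices M'" "mat2 1 t 0 1 \<in> semidiscrete_matrices.U M'"
        "mat2 a b c d \<in> semidiscrete_matrices.U M'"
      using conj[OF parabolic(1,3) H(1)] by (auto simp: He)
    have "fricke (trace F) (trace G) (trace (F ** G)) - 2 = (c * t)\<^sup>2"
      unfolding H(4) H(3,5)[symmetric] He by (simp add: fricke_def power2_eq_square algebra_simps)
    then have "(c * t)\<^sup>2 < 1" using small by (simp add: H(4))
    then have "c = 0"
      by (rule semidiscrete_matrices.joergensen_parabolic[OF M'(1,2) parabolic(2) M'(3)])
    moreover from this have "a \<noteq> 0" using det by auto
    ultimately have "elementary_pair (mat2 1 t 0 1) H"
      using elementary_pair_None[of 1 a t 1 b d] by (simp add: He)
    then show ?thesis by (rule red[OF parabolic(1,3) H(1)])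
  next
    case (elliptic P k s)
    obtain H where H: "G ** P = P ** H" "det H = 1" "trace H = trace G" "trace F = trace (mat2 k (-s) s k)"
        "trace (mat2 k (-s) s k ** H) = trace (F ** G)"
      by (rule conj_normal_form[OF elliptic(1,4) dG]) blast
    obtain a b c d where He: "H = mat2 a b c d" by (rule mat2_cases)
    have det: "a * d - b * c = 1" using H(2) by (simp add: He)
    obtain M' where M': "semidiscrete_matrices M'" "mat2 k (-s) s k \<in> semidiscrete_matrices.U M'"
        "mat2 a b c d \<in> semidiscrete_matrices.U M'"
      using conj[OF elliptic(1,4) H(1)] by (auto simp: He)
    define n where "n = ((a - d)\<^sup>2 + (b + c)\<^sup>2) / 4"
    have "fricke (trace F) (trace G) (trace (F ** G)) - 2 = 4 * s\<^sup>2 * n"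
      unfolding H(4) H(3,5)[symmetric] He fricke_def n_def using det elliptic(3) by simp algebra
    moreover have "(trace F)\<^sup>2 - 4 = - (4 * s\<^sup>2)"
      unfolding H(4) using elliptic(3) by (simp add: power2_eq_square algebra_simps)
    moreover have "0 \<le> n" by (simp add: n_def)
    ultimately have "4 * s\<^sup>2 * (1 + n) < 1"
      using small by (simp add: abs_mult algebra_simps)
    then have "a = d \<and> c = - b"
      unfolding n_def by (rule semidiscrete_matrices.joergensen_elliptic[OF M'(1,2) elliptic(2) M'(3)])
    then have "elementary_pair (mat2 k (-s) s k) H"
      using det elementary_pair_rotation[OF elliptic(3), of d "-b"] by (auto simp: He power2_eq_square)
    then show ?thesis by (rule red[OF elliptic(1,4) H(1)])
  qed
qed

lemma common_cone_if_small:
  assumes M: "F \<in> M" "G \<in> M" and tr: "0 \<le> trace F" "0 \<le> trace G"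
    and ne: "\<not> elementary_pair F G"
    and small: "\<bar>(trace F)\<^sup>2 - 4\<bar> + \<bar>fricke (trace F) (trace G) (trace (F ** G)) - 2\<bar> < 1"
  shows "\<exists>P. common_cone P F G"
proof (rule ccontr)
  assume no: "\<nexists>P. common_cone P F G"
  define \<kappa> where "\<kappa> = fricke (trace F) (trace G) (trace (F ** G))"
  \<comment> \<open>This lies below the bounds 6 and 18 of the two arguments that produce elliptic
    words.\<close>
  have \<kappa>: "\<kappa> < 3" using small unfolding \<kappa>_def by linarith
  have \<kappa>': "fricke (trace G) (trace F) (trace (G ** F)) = \<kappa>"
    unfolding \<kappa>_def trace_mul_sym[of G F] by (simp add: fricke_def)
  have "F \<in> U \<and> G \<in> U"
  proof (cases "trace F < 2 \<or> trace G < 2")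
    case True
    then show ?thesis
    proof
      assume "trace F < 2"
      then show ?thesis
        using elliptic_in_U[of F] elliptic_generator_in_U[of F G] M tr \<kappa> by (simp add: \<kappa>_def)
    next
      assume "trace G < 2"
      then show ?thesis
        using elliptic_in_U[of G] elliptic_generator_in_U[of G F] M tr \<kappa> \<kappa>' by simp
    qed
  next
    case False
    then have tr2: "2 \<le> trace F" "2 \<le> trace G" by auto
    have "F \<noteq> mat 1" using elementary_pair_one[of G] ne M tr det_M by auto
    note cone = real_pair_cone[OF det_M[OF M(1)] det_M[OF M(2)] tr2 this ne, folded \<kappa>_def]
    \<comment> \<open>Without a common cone, \<open>real_pair_cone\<close> leaves only the case of
      opposite directions.\<close>
    have "2 < \<kappa>" and le: "2 * trace (F ** G) \<le> trace F * trace G" using cone no by force+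
    define \<eta> where "\<eta> = sqrt (\<kappa> - 2)"
    have \<eta>: "\<eta> > 0" "\<eta>\<^sup>2 = \<kappa> - 2" using \<open>2 < \<kappa>\<close> by (simp_all add: \<eta>_def)
    obtain n :: nat where "(trace F + trace G) / \<eta> \<le> n" using real_arch_simple by blast
    then have "trace F + trace G \<le> \<eta> * n" using \<eta> by (simp add: field_simps)
    then show ?thesis
      using antiparallel_in_U[OF M tr2 le \<eta>(1)] \<eta>(2) \<kappa> by (simp add: \<kappa>_def)
  qed
  then show False using joergensen[of F G] tr ne small by blast
qed

end

theorem theorem12p11:
  fixes f g :: "complex option \<Rightarrow> complex option"
    and F G :: "real^2^2"
  assumes "f \<in> moebius_group" and "g \<in> moebius_group"
    and "\<not> elementary (semigroup_generated {f, g})"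
    and "semidiscrete (semigroup_generated {f, g})"
    and "is_lift F f" and "is_lift G g"
  shows "(\<exists>J. closed_interval J \<and> strictly_inside_itself f J \<and> strictly_inside_itself g J) \<or>
         \<bar>(trace F)\<^sup>2 - 4\<bar> + \<bar>trace (commutator F G) - 2\<bar> \<ge> 1"
proof (rule disjCI)
  assume "\<not> \<bar>(trace F)\<^sup>2 - 4\<bar> + \<bar>trace (commutator F G) - 2\<bar> \<ge> 1"
  then have small: "\<bar>(trace F)\<^sup>2 - 4\<bar> + \<bar>trace (commutator F G) - 2\<bar> < 1" by simp
  have F: "det F = 1" "moebius_map F = f" and G: "det G = 1" "moebius_map G = g"
    using assms(5,6) by (auto simp: is_lift_def SL2_def)
  define S where "S = semigroup_generated {f, g}"
  have fg: "f \<in> S" "g \<in> S" by (auto simp: S_def intro: semigroup_generated.gen)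
  have "h \<in> moebius_map ` SL2" if "h \<in> S" for h
    using that unfolding S_def
  proof (induction rule: semigroup_generated.induct)
    case (gen h) then show ?case using assms(1,2) by (auto simp: moebius_group_eq_SL2)
  next
    case (comp h k)
    then obtain A B where AB: "det A = 1" "h = moebius_map A" "det B = 1" "k = moebius_map B"
      by (auto simp: SL2_def)
    then have "h \<circ> k = moebius_map (A ** B)" by (simp add: moebius_map_mult)
    then show ?case using AB by (auto simp: SL2_def det_mul)
  qed
  then have "S \<subseteq> moebius_group" by (auto simp: moebius_group_eq_SL2)
  then interpret semidiscrete_matrices "{A. det A = 1 \<and> moebius_map A \<in> S}"
    using assms(4) by (intro semidiscrete_matrices_lifts) (auto simp: S_def intro: semigroup_generated.comp)
  \<comment> \<open>Both terms of the inequality are unchanged when a lift is negated, so lifts of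
    nonnegative trace may be used.\<close>
  define F' where "F' = (if 0 \<le> trace F then F else - F)"
  define G' where "G' = (if 0 \<le> trace G then G else - G)"
  have F': "det F' = 1" "moebius_map F' = f" "0 \<le> trace F'"
    and G': "det G' = 1" "moebius_map G' = g" "0 \<le> trace G'"
    using F G by (auto simp: F'_def G'_def det_uminus2 moebius_map_uminus trace_uminus2)
  have "\<exists>P. common_cone P F' G'"
  proof (rule common_cone_if_small)
    show "\<not> elementary_pair F' G'"
      using assms(3) elementary_preserves_pair by (auto simp: elementary_pair_def F' G')
    have "trace (commutator F G) = fricke (trace F') (trace G') (trace (F' ** G'))"
      unfolding trace_commutator[OF F(1) G(1)] fricke_def
      by (simp add: F'_def G'_def trace_uminus2 mult_uminus2)
    moreover have "(trace F')\<^sup>2 = (trace F)\<^sup>2" by (simp add: F'_def trace_uminus2)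
    ultimately show "\<bar>(trace F')\<^sup>2 - 4\<bar> + \<bar>fricke (trace F') (trace G') (trace (F' ** G')) - 2\<bar> < 1"
      using small by simp
  qed (use F' G' fg in simp_all)
  then obtain P where P: "common_cone P F' G'" ..
  then have "closed_interval (arc P)" by (simp add: common_cone_def closed_interval_arc)
  moreover have "strictly_inside_itself f (arc P)" "strictly_inside_itself g (arc P)"
    using P strictly_inside_arc[OF F'(1)] strictly_inside_arc[OF G'(1)] F'(2) G'(2)
    unfolding common_cone_def by blast+
  ultimately show "\<exists>J. closed_interval J \<and> strictly_inside_itself f J \<and> strictly_inside_itself g J"
    by blast
qed

end
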